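(* For $n\ge 1$, the distribution of right edges over the set of standard local binary search trees on $n$ nodes, i.e. the polynomial $\sum_{T}t^{\mathrm{r}(T)}$ (summed over standard local binary search trees $T$ on $n$ nodes, with $\mathrm{r}(T)$ the number of right edges of $T$), is $\gamma$-nonnegative. Equivalently, the polynomials $f_n(t)=\sum_{k\ge1}f_{nk}t^k$ considered by Postnikov are $\gamma$-nonnegative, where $f_{nk}$ is the number of intransitive trees on $[n+1]$ with $k$ right vertices. As a corollary, the sequence of coefficients of $f_n(t)$ is unimodal.
   Context: A plane binary tree is a rooted tree in which every node has at most one left child and at most one right child (it may have only one of the two), and no other children; an edge to a right child is a right edge. A standard local binary search tree on $n$ nodes is a plane binary tree on $n$ nodes labeled bijectively by $[n]=\{1,\dots,n\}$ such that the label of every left child is less than the label of its parent and the label of every right child is greater than the label of its parent. An intransitive tree on $[m]$ is a tree (connected acyclic graph, neither plane nor rooted, not necessarily binary) on vertex set $[m]$ such that each vertex is either greater than all of its neighbors (a right vertex) or less than all of its neighbors (a left vertex). The two formulations are related by the fact that, for $n\ge1$, the number of intransitive trees on $[n+1]$ with $k$ right vertices equals the number of standard local binary search trees on $n$ nodes with $k-1$ right edges. A polynomial $P(t)$ of degree $d\ge 0$ is $\gamma$-nonnegative if it has an expansion $P(t)=\sum_{j=0}^{\lfloor d/2\rfloor}\gamma_{d,j}\,t^j(1+t)^{d-2j}$ with all $\gamma_{d,j}\ge 0$.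
   Formalization: The polynomial f_n(t) has zero constant term, so it is never γ-nonnegative in the sense defined (e.g. f_1(t)=t is not γ(1+t)); what is stated and proved instead is that f_n(t)=t·q(t) with q(t) γ-nonnegative. *)

theory Defs
  imports "HOL-Library.Tree" "HOL-Computational_Algebra.Polynomial"
begin

text \<open>A plane binary tree with labelled nodes is a \<^typ>\<open>nat tree\<close>; \<^const>\<open>Leaf\<close> stands for an
  absent child, so that nodes and edges in the mathematical sense are \<^const>\<open>Node\<close>s and pairs
  of directly nested \<^const>\<open>Node\<close>s.\<close>

fun local_bst :: "nat tree \<Rightarrow> bool" where
  "local_bst Leaf \<longleftrightarrow> True"
| "local_bst (Node l a r) \<longleftrightarrow>
     (l \<noteq> Leaf \<longrightarrow> value l < a) \<and> (r \<noteq> Leaf \<longrightarrow> a < value r) \<and> local_bst l \<and> local_bst r"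

text \<open>The two conditions \<open>size T = n\<close> and \<open>set_tree T = {1..n}\<close> together say that the labelling
  is a bijection from the nodes of \<open>T\<close> to \<open>[n]\<close>.\<close>

definition standard_local_bsts :: "nat \<Rightarrow> nat tree set" where
  "standard_local_bsts n = {T. size T = n \<and> set_tree T = {1..n} \<and> local_bst T}"

fun right_edges :: "'a tree \<Rightarrow> nat" where
  "right_edges Leaf = 0"
| "right_edges (Node l a r) = right_edges l + right_edges r + (if r = Leaf then 0 else 1)"

definition local_bst_poly :: "nat \<Rightarrow> real poly" where
  "local_bst_poly n = (\<Sum>T\<in>standard_local_bsts n. monom 1 (right_edges T))"

text \<open>A simple graph on \<open>V\<close> is given by its set \<open>E\<close> of edges, which are two-element subsets
  of \<open>V\<close>.\<close>

definition simple_graph :: "'a set \<Rightarrow> 'a set set \<Rightarrow> bool" where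
  "simple_graph V E \<longleftrightarrow> (\<forall>e\<in>E. e \<subseteq> V \<and> card e = 2)"

definition connected_graph :: "'a set \<Rightarrow> 'a set set \<Rightarrow> bool" where
  "connected_graph V E \<longleftrightarrow> V \<noteq> {} \<and> (\<forall>u\<in>V. \<forall>v\<in>V. (u, v) \<in> {(x, y). {x, y} \<in> E}\<^sup>*)"

text \<open>A cycle is listed by its vertices; the index modulo the length closes it up.\<close>

definition graph_cycle :: "'a set set \<Rightarrow> 'a list \<Rightarrow> bool" where
  "graph_cycle E xs \<longleftrightarrow> 3 \<le> length xs \<and> distinct xs \<and>
     (\<forall>i<length xs. {xs ! i, xs ! (Suc i mod length xs)} \<in> E)"

definition tree_graph :: "'a set \<Rightarrow> 'a set set \<Rightarrow> bool" where
  "tree_graph V E \<longleftrightarrow> simple_graph V E \<and> connected_graph V E \<and> \<not> (\<exists>xs. graph_cycle E xs)"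

definition right_vertex :: "nat set set \<Rightarrow> nat \<Rightarrow> bool" where
  "right_vertex E v \<longleftrightarrow> (\<forall>u. {u, v} \<in> E \<longrightarrow> u < v)"

definition left_vertex :: "nat set set \<Rightarrow> nat \<Rightarrow> bool" where
  "left_vertex E v \<longleftrightarrow> (\<forall>u. {u, v} \<in> E \<longrightarrow> v < u)"

definition intransitive_trees :: "nat \<Rightarrow> nat set set set" where
  "intransitive_trees m =
     {E. tree_graph {1..m} E \<and> (\<forall>v\<in>{1..m}. right_vertex E v \<or> left_vertex E v)}"

definition intransitive_count :: "nat \<Rightarrow> nat \<Rightarrow> nat" where
  "intransitive_count n k =
     card {E \<in> intransitive_trees (n + 1). card {v \<in> {1..n + 1}. right_vertex E v} = k}"

text \<open>The sum over all \<open>k \<ge> 1\<close> can stop at the number \<open>n + 1\<close> of vertices.\<close>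

definition intransitive_poly :: "nat \<Rightarrow> real poly" where
  "intransitive_poly n = (\<Sum>k = 1..n + 1. monom (real (intransitive_count n k)) k)"

text \<open>The expansion is taken relative to the degree, hence symmetric about \<open>degree p / 2\<close>. It
  does not apply directly to \<open>intransitive_poly n\<close>, which has degree \<open>n\<close> but constant term \<open>0\<close>
  and centre of symmetry \<open>(n + 1) / 2\<close>; the factor \<open>t\<close> has to be split off first.\<close>

definition gamma_nonneg :: "real poly \<Rightarrow> bool" where
  "gamma_nonneg p \<longleftrightarrow> p \<noteq> 0 \<and>
     (\<exists>\<gamma> :: nat \<Rightarrow> real. (\<forall>j \<le> degree p div 2. 0 \<le> \<gamma> j) \<and>
        p = (\<Sum>j \<le> degree p div 2. monom (\<gamma> j) j * [:1, 1:] ^ (degree p - 2 * j)))"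

text \<open>For the coefficients of a polynomial the sequence includes the zeros beyond the degree,
  which make no difference when the coefficients are nonnegative.\<close>

definition unimodal :: "(nat \<Rightarrow> real) \<Rightarrow> bool" where
  "unimodal a \<longleftrightarrow> (\<exists>m. mono_on {..m} a \<and> antimono_on {m..} a)"

text \<open>The sum and the cardinalities above range over finite sets.\<close>

lemma finite_trees_size: "finite A \<Longrightarrow> finite {T. size T = n \<and> set_tree T \<subseteq> A}"
proof (induction n rule: less_induct)
  case (less n)
  define B where "B = (\<Union>k<n. {T. size T = k \<and> set_tree T \<subseteq> A})"
  have "finite B" unfolding B_def using less by (intro finite_UN_I finite_lessThan) simp
  have "{T. size T = n \<and> set_tree T \<subseteq> A} \<subseteq>
      insert Leaf ((\<lambda>(l, a, r). Node l a r) ` (B \<times> A \<times> B))"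
  proof
    fix T assume T: "T \<in> {T. size T = n \<and> set_tree T \<subseteq> A}"
    show "T \<in> insert Leaf ((\<lambda>(l, a, r). Node l a r) ` (B \<times> A \<times> B))"
    proof (cases T)
      case (Node l a r)
      have "l \<in> B" "a \<in> A" "r \<in> B"
        using T by (simp_all add: B_def Node)
      then have "(\<lambda>(l, a, r). Node l a r) (l, a, r) \<in>
          (\<lambda>(l, a, r). Node l a r) ` (B \<times> A \<times> B)"
        by (intro imageI) simp
      then show ?thesis by (simp add: Node)
    qed simp
  qed
  moreover have "finite (insert Leaf ((\<lambda>(l, a, r). Node l a r) ` (B \<times> A \<times> B)))"
    using \<open>finite B\<close> less.prems by blast
  ultimately show ?case by (rule finite_subset)
qed

lemma finite_standard_local_bsts: "finite (standard_local_bsts n)"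
  by (rule finite_subset[OF _ finite_trees_size[of "{1..n}" n]])
    (auto simp: standard_local_bsts_def)

lemma finite_intransitive_trees: "finite (intransitive_trees m)"
  by (rule finite_subset[of _ "Pow (Pow {1..m})"])
    (auto simp: intransitive_trees_def tree_graph_def simple_graph_def)

end

theory Submission
  imports Defs "HOL-Computational_Algebra.Formal_Power_Series" "HOL-Library.Infinite_Set"
begin

text \<open>Let \<open>B\<close> be the exponential generating function of the nonempty local binary search trees with
  weight \<open>a\<close> per left and \<open>b\<close> per right edge, and let \<open>G\<close> and \<open>H\<close> count those whose root has no right,
  respectively no left, child. Right spines are increasing, hence determined by the set of their
  nodes with left subtrees, so \<open>1 + b B = exp (b G)\<close>, and by symmetry \<open>1 + a B = exp (a H)\<close>.
  Moreover \<open>b G + a H = x y\<close> for \<open>y = a + b + a b B\<close>. Multiplying gives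
  \<open>1 + y B = (1 + a B) (1 + b B) = exp (x y)\<close>, that is,
  \<open>B = x + x\<^sup>2 y / 2! + x\<^sup>3 y\<^sup>2 / 3! + \<dots>\<close>. Recursively, the coefficients of \<open>B\<close> are
  polynomials in \<open>a + b\<close> and \<open>a b\<close> with nonnegative coefficients, which for \<open>a = 1\<close>, \<open>b = t\<close> is
  \<open>\<gamma>\<close>-nonnegativity. Intransitive trees, rooted at their least vertex, are turned into local binary
  search trees by a child-sibling encoding in which the order is reversed at every level; right
  vertices become the root and the right children.\<close>

section \<open>Local binary search trees with respect to an order\<close>

text \<open>The order is a predicate and not a type class because the same labels carry an order and
  its converse: mirror images and alternate levels of the graph encoding use the reversed
  one.\<close>

locale strict_linear_order =
  fixes R :: "'a \<Rightarrow> 'a \<Rightarrow> bool"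
  assumes irrefl: "\<not> R x x"
    and trans: "R x y \<Longrightarrow> R y z \<Longrightarrow> R x z"
    and total: "x \<noteq> y \<Longrightarrow> R x y \<or> R y x"
begin

lemma asym: "R x y \<Longrightarrow> \<not> R y x"
  using irrefl trans by blast

lemma converse: "strict_linear_order R\<inverse>\<inverse>"
  by unfold_locales (auto simp: irrefl dest: trans total)

end

lemma strict_linear_order_less: "strict_linear_order ((<) :: 'a::linorder \<Rightarrow> 'a \<Rightarrow> bool)"
  by unfold_locales auto

fun lbst_wrt :: "('a \<Rightarrow> 'a \<Rightarrow> bool) \<Rightarrow> 'a tree \<Rightarrow> bool" where
  "lbst_wrt R Leaf \<longleftrightarrow> True"
| "lbst_wrt R (Node l a r) \<longleftrightarrow>
     (l \<noteq> Leaf \<longrightarrow> R (value l) a) \<and> (r \<noteq> Leaf \<longrightarrow> R a (value r)) \<and> lbst_wrt R l \<and> lbst_wrt R r"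

lemma local_bst_eq_lbst_wrt: "local_bst T = lbst_wrt (<) T"
  by (induction T) auto

definition lbsts :: "('a \<Rightarrow> 'a \<Rightarrow> bool) \<Rightarrow> 'a set \<Rightarrow> 'a tree set" where
  "lbsts R A = {T. lbst_wrt R T \<and> distinct (inorder T) \<and> set_tree T = A}"

lemma size_eq_card_iff: "size T = card (set_tree T) \<longleftrightarrow> distinct (inorder T)"
  by (metis card_distinct distinct_card length_inorder set_inorder)

lemma standard_local_bsts_eq: "standard_local_bsts n = lbsts (<) {1..n}"
  unfolding standard_local_bsts_def lbsts_def local_bst_eq_lbst_wrt
  by (auto simp flip: size_eq_card_iff)

lemma finite_lbsts: "finite A \<Longrightarrow> finite (lbsts R A)"
  by (rule finite_subset[OF _ finite_trees_size[of A "card A"]])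
    (auto simp: lbsts_def simp flip: size_eq_card_iff)

lemma lbsts_empty [simp]: "lbsts R {} = {Leaf}"
  by (auto simp: lbsts_def eq_set_tree_empty)

lemma Leaf_in_lbsts_iff [simp]: "Leaf \<in> lbsts R A \<longleftrightarrow> A = {}"
  by (auto simp: lbsts_def)

lemma value_mirror [simp]: "T \<noteq> Leaf \<Longrightarrow> value (mirror T) = value T"
  by (cases T) auto

lemma lbst_wrt_mirror [simp]: "lbst_wrt R (mirror T) \<longleftrightarrow> lbst_wrt R\<inverse>\<inverse> T"
  by (induction T) auto

lemma set_tree_mirror [simp]: "set_tree (mirror T) = set_tree T"
  by (induction T) auto

lemma mirror_in_lbsts_iff: "mirror T \<in> lbsts R A \<longleftrightarrow> T \<in> lbsts R\<inverse>\<inverse> A"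
  by (auto simp: lbsts_def inorder_mirror)

lemma value_in_set_tree: "T \<noteq> Leaf \<Longrightarrow> value T \<in> set_tree T"
  by (cases T) auto

text \<open>Mirroring exchanges left and right edges, so \<open>right_edges (mirror T)\<close>
  counts the left edges.\<close>

definition edge_weight :: "real \<Rightarrow> real \<Rightarrow> 'a tree \<Rightarrow> real" where
  "edge_weight a b T = a ^ right_edges (mirror T) * b ^ right_edges T"

lemma edge_weight_Leaf [simp]: "edge_weight a b Leaf = 1"
  by (simp add: edge_weight_def)

lemma edge_weight_Node [simp]:
  "edge_weight a b (Node l v r) = (if l = Leaf then 1 else a) * edge_weight a b l *
    ((if r = Leaf then 1 else b) * edge_weight a b r)"
  by (simp add: edge_weight_def power_add)

lemma edge_weight_mirror: "edge_weight a b (mirror T) = edge_weight b a T"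
  by (simp add: edge_weight_def)

definition tree_sum :: "('a \<Rightarrow> 'a \<Rightarrow> bool) \<Rightarrow> real \<Rightarrow> real \<Rightarrow> 'a set \<Rightarrow> real" where
  "tree_sum R a b A = (\<Sum>T\<in>lbsts R A. edge_weight a b T)"

text \<open>Up to factorials these are the coefficients of G; such a tree is one piece of a right
  spine.\<close>

definition spineless_sum :: "('a \<Rightarrow> 'a \<Rightarrow> bool) \<Rightarrow> real \<Rightarrow> real \<Rightarrow> 'a set \<Rightarrow> real" where
  "spineless_sum R a b A = (\<Sum>T\<in>{T \<in> lbsts R A. T \<noteq> Leaf \<and> right T = Leaf}. edge_weight a b T)"

text \<open>The weight of \<open>T\<close> hung below a node as its right subtree: the connecting
  edge costs a factor \<open>b\<close>, unless \<open>T\<close> is empty.\<close>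

definition attached_sum :: "('a \<Rightarrow> 'a \<Rightarrow> bool) \<Rightarrow> real \<Rightarrow> real \<Rightarrow> 'a set \<Rightarrow> real" where
  "attached_sum R a b A = (\<Sum>T\<in>lbsts R A. (if T = Leaf then 1 else b) * edge_weight a b T)"

lemma attached_sum_eq: "attached_sum R a b A = (if A = {} then 1 else b * tree_sum R a b A)"
proof (cases "A = {}")
  case False
  then have "T \<noteq> Leaf" if "T \<in> lbsts R A" for T using that by auto
  with False show ?thesis
    unfolding attached_sum_def tree_sum_def sum_distrib_left by (simp cong: sum.cong)
qed (simp add: attached_sum_def)

lemma tree_sum_mirror: "tree_sum R\<inverse>\<inverse> a b A = tree_sum R b a A"
  unfolding tree_sum_def
  by (rule sum.reindex_bij_witness[of _ mirror mirror])
    (auto simp: mirror_in_lbsts_iff edge_weight_mirror)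

section \<open>Cutting and inserting along the right spine\<close>

fun spine_insert :: "('a \<Rightarrow> 'a \<Rightarrow> bool) \<Rightarrow> 'a tree \<Rightarrow> 'a \<Rightarrow> 'a tree \<Rightarrow> 'a tree" where
  "spine_insert R l v Leaf = Node l v Leaf"
| "spine_insert R l v (Node l' v' r') =
     (if R v v' then Node l v (Node l' v' r') else Node l' v' (spine_insert R l v r'))"

text \<open>Together with \<open>spine_rest\<close> this undoes \<open>spine_insert\<close>; the
  label \<open>m\<close> selects the spine node that is cut out with its left subtree.\<close>

fun spine_part :: "'a \<Rightarrow> 'a tree \<Rightarrow> 'a tree" where
  "spine_part m Leaf = Leaf"
| "spine_part m (Node l v r) = (if m \<in> insert v (set_tree l) then Node l v Leaf else spine_part m r)"

fun spine_rest :: "'a \<Rightarrow> 'a tree \<Rightarrow> 'a tree" where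
  "spine_rest m Leaf = Leaf"
| "spine_rest m (Node l v r) = (if m \<in> insert v (set_tree l) then r else Node l v (spine_rest m r))"

lemma spine_insert_not_Leaf [simp]: "spine_insert R l v T \<noteq> Leaf"
  by (cases T) auto

lemma value_spine_insert:
  "value (spine_insert R l v T) = (if T = Leaf \<or> R v (value T) then v else value T)"
  by (cases T) auto

lemma set_spine_insert [simp]:
  "set_tree (spine_insert R l v T) = insert v (set_tree l \<union> set_tree T)"
  by (induction T) auto

lemma distinct_spine_insert:
  "distinct (inorder (spine_insert R l v T)) \<longleftrightarrow>
    distinct (inorder (Node l v Leaf)) \<and> distinct (inorder T) \<and> insert v (set_tree l) \<inter> set_tree T = {}"
  by (induction T) auto

text \<open>Wherever the new node lands on a nonempty spine, exactly one right edge is added to the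
  edges of the two parts.\<close>

lemma edge_weight_spine_insert:
  "edge_weight a b (spine_insert R l v T) =
    edge_weight a b (Node l v Leaf) * ((if T = Leaf then 1 else b) * edge_weight a b T)"
  by (induction T) auto

lemma spine_part_insert:
  "insert v (set_tree l) \<inter> set_tree T = {} \<Longrightarrow> m \<in> insert v (set_tree l) \<Longrightarrow>
    spine_part m (spine_insert R l v T) = Node l v Leaf"
  by (induction T) auto

lemma spine_rest_insert:
  "insert v (set_tree l) \<inter> set_tree T = {} \<Longrightarrow> m \<in> insert v (set_tree l) \<Longrightarrow>
    spine_rest m (spine_insert R l v T) = T"
  by (induction T) auto

lemma spine_part_Node: "m \<in> set_tree T \<Longrightarrow> \<exists>l v. spine_part m T = Node l v Leaf"
  by (induction T) auto

lemma right_spine_part [simp]: "right (spine_part m T) = Leaf"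
  by (induction T) auto

lemma mem_spine_part: "m \<in> set_tree T \<Longrightarrow> m \<in> set_tree (spine_part m T)"
  by (induction T) auto

lemma set_spine_part_rest:
  "m \<in> set_tree T \<Longrightarrow> set_tree T = set_tree (spine_part m T) \<union> set_tree (spine_rest m T)"
  by (induction T) auto

lemma distinct_spine_part_rest:
  "distinct (inorder T) \<Longrightarrow> m \<in> set_tree T \<Longrightarrow>
    distinct (inorder (spine_part m T)) \<and> distinct (inorder (spine_rest m T)) \<and>
    set_tree (spine_part m T) \<inter> set_tree (spine_rest m T) = {}"
proof (induction T)
  case (Node l v r)
  then show ?case using set_spine_part_rest[of m r] by (auto split: if_splits)
qed auto

lemma lbst_spine_part: "lbst_wrt R T \<Longrightarrow> lbst_wrt R (spine_part m T)"
  by (induction T) auto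

context strict_linear_order
begin

lemma lbst_spine_insert:
  "lbst_wrt R (Node l v Leaf) \<Longrightarrow> lbst_wrt R T \<Longrightarrow> v \<notin> set_tree T \<Longrightarrow> lbst_wrt R (spine_insert R l v T)"
proof (induction T)
  case (Node l' v' r')
  then show ?case using total[of v v'] by (auto simp: value_spine_insert)
qed auto

lemma lbst_value_le_spine_rest:
  "lbst_wrt R T \<Longrightarrow> spine_rest m T \<noteq> Leaf \<Longrightarrow> value (spine_rest m T) = value T \<or> R (value T) (value (spine_rest m T))"
  by (cases T) auto

lemma lbst_value_le_spine_part:
  "lbst_wrt R T \<Longrightarrow> m \<in> set_tree T \<Longrightarrow> value (spine_part m T) = value T \<or> R (value T) (value (spine_part m T))"
  by (induction T) (auto dest: trans)

lemma lbst_spine_rest: "lbst_wrt R T \<Longrightarrow> lbst_wrt R (spine_rest m T)"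
proof (induction T)
  case (Node l v r)
  then have "R v (value (spine_rest m r))" if "spine_rest m r \<noteq> Leaf"
    using lbst_value_le_spine_rest[of r m] that by (cases r) (auto dest: trans)
  then show ?case using Node by auto
qed auto

lemma spine_insert_part_rest:
  "lbst_wrt R T \<Longrightarrow> m \<in> set_tree T \<Longrightarrow>
    spine_insert R (left (spine_part m T)) (value (spine_part m T)) (spine_rest m T) = T"
proof (induction T)
  case (Node l v r)
  show ?case
  proof (cases "m \<in> insert v (set_tree l)")
    case True
    then show ?thesis using Node.prems by (cases r) auto
  next
    case False
    then have m: "m \<in> set_tree r" using Node.prems by auto
    \<comment> \<open>Labels increase down the spine, so the reinsertion has to pass over
      \<open>v\<close>.\<close>
    have "R v (value (spine_part m r))"
      using lbst_value_le_spine_part[OF _ m] Node.prems m by (cases r) (auto dest: trans)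
    then show ?thesis using False Node m asym by auto
  qed
qed auto

text \<open>The labels along a right spine are sorted, so a spine node together with its left subtree
  can be cut out and reinserted in exactly one way; we do this for the one containing \<open>m\<close>.\<close>

lemma tree_sum_by_spine:
  assumes "finite A" "m \<in> A"
  shows "tree_sum R a b A =
    (\<Sum>S | S \<subseteq> A \<and> m \<in> S. spineless_sum R a b S * attached_sum R a b (A - S))"
proof -
  let ?G = "\<lambda>S. {T \<in> lbsts R S. T \<noteq> Leaf \<and> right T = Leaf}"
  let ?I = "SIGMA S:{S. S \<subseteq> A \<and> m \<in> S}. ?G S \<times> lbsts R (A - S)"
  let ?ins = "\<lambda>(S, g, T). spine_insert R (left g) (value g) T"
  let ?part = "\<lambda>T. (set_tree (spine_part m T), spine_part m T, spine_rest m T)"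
  have fin: "finite {S. S \<subseteq> A \<and> m \<in> S}" using assms by auto
  have fin': "finite (?G S)" "finite (lbsts R (A - S))" if "S \<subseteq> A" for S
    using that assms finite_subset finite_lbsts by (auto simp: finite_subset finite_lbsts)
  have "(\<Sum>S | S \<subseteq> A \<and> m \<in> S. spineless_sum R a b S * attached_sum R a b (A - S)) =
     (\<Sum>(S, g, T)\<in>?I. edge_weight a b g * ((if T = Leaf then 1 else b) * edge_weight a b T))"
    unfolding spineless_sum_def attached_sum_def
    by (subst sum.Sigma[symmetric])
      (use fin fin' in \<open>auto intro!: sum.cong simp: sum_product sum.cartesian_product\<close>)
  also have "\<dots> = tree_sum R a b A"
    unfolding tree_sum_def
  proof (rule sum.reindex_bij_witness[of _ ?part ?ins])
    fix p assume "p \<in> ?I"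
    then obtain S l v T where p: "p = (S, Node l v Leaf, T)" "S \<subseteq> A" "m \<in> S"
      "Node l v Leaf \<in> lbsts R S" "T \<in> lbsts R (A - S)"
      by (auto simp: neq_Leaf_iff)
    \<comment> \<open>The first component of the triple is determined by the second, so recording it
      loses and adds nothing.\<close>
    then have S: "S = insert v (set_tree l)" by (auto simp: lbsts_def)
    have disj: "insert v (set_tree l) \<inter> set_tree T = {}"
      using p by (auto simp: lbsts_def)
    show "?part (?ins p) = p"
      using p disj S by (simp add: spine_part_insert spine_rest_insert)
    show "?ins p \<in> lbsts R A"
      using p disj lbst_spine_insert[of l v T] unfolding lbsts_def by (auto simp: distinct_spine_insert)
    show "edge_weight a b (?ins p) = (case p of (S, g, T) \<Rightarrow>
        edge_weight a b g * ((if T = Leaf then 1 else b) * edge_weight a b T))"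
      using p by (simp add: edge_weight_spine_insert)
  next
    fix T assume T: "T \<in> lbsts R A"
    then have m: "m \<in> set_tree T" using assms by (auto simp: lbsts_def)
    show "?ins (?part T) = T"
      using T m spine_insert_part_rest by (auto simp: lbsts_def)
    obtain l v where "spine_part m T = Node l v Leaf" using spine_part_Node[OF m] by blast
    then show "?part T \<in> ?I"
      using T m distinct_spine_part_rest[of T m] set_spine_part_rest[OF m] mem_spine_part[OF m]
        lbst_spine_part[of R T m] lbst_spine_rest[of T m]
      unfolding lbsts_def by auto
  qed
  finally show ?thesis by simp
qed

end

lemma Diff_singleton_ne:
  assumes "finite A" "card A \<ge> 2"
  shows "A - {v} \<noteq> {}"
proof
  assume "A - {v} = {}"
  then have "card A \<le> card {v}" by (intro card_mono) auto
  then show False using assms by simp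
qed

text \<open>With at least two labels the left subtree of the root is nonempty, whence the factor
  \<open>a\<close>; it carries all labels but the root label \<open>v\<close>.\<close>

lemma spineless_sum_eq:
  assumes "finite A" "card A \<ge> 2"
  shows "spineless_sum R a b A =
    (\<Sum>v\<in>A. \<Sum>l\<in>{l \<in> lbsts R (A - {v}). R (value l) v}. a * edge_weight a b l)"
proof -
  let ?I = "SIGMA v:A. {l \<in> lbsts R (A - {v}). R (value l) v}"
  have ne: "A - {v} \<noteq> {}" for v
    using assms by (rule Diff_singleton_ne)
  have "(\<Sum>v\<in>A. \<Sum>l\<in>{l \<in> lbsts R (A - {v}). R (value l) v}. a * edge_weight a b l) =
      (\<Sum>(v, l)\<in>?I. a * edge_weight a b l)"
    by (rule sum.Sigma) (use assms in \<open>auto simp: finite_lbsts\<close>)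
  also have "\<dots> = spineless_sum R a b A"
    unfolding spineless_sum_def
  proof (rule sum.reindex_bij_witness[of _ "\<lambda>T. (value T, left T)" "\<lambda>(v, l). Node l v Leaf"])
    fix p assume "p \<in> ?I"
    then obtain v l where p: "p = (v, l)" "v \<in> A" "l \<in> lbsts R (A - {v})" "R (value l) v" by blast
    then have "l \<noteq> Leaf" using ne[of v] by auto
    then show "edge_weight a b (case p of (v, l) \<Rightarrow> Node l v Leaf) = (case p of (v, l) \<Rightarrow> a * edge_weight a b l)"
      using p by simp
    show "(case p of (v, l) \<Rightarrow> Node l v Leaf) \<in> {T \<in> lbsts R A. T \<noteq> Leaf \<and> right T = Leaf}"
      using p by (auto simp: lbsts_def)
  next
    fix T assume "T \<in> {T \<in> lbsts R A. T \<noteq> Leaf \<and> right T = Leaf}"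
    then obtain l v where T: "T = Node l v Leaf" "T \<in> lbsts R A" by (auto simp: neq_Leaf_iff)
    then have "set_tree l = A - {v}" "v \<in> A" by (auto simp: lbsts_def)
    then show "(value T, left T) \<in> ?I" "(case (value T, left T) of (v, l) \<Rightarrow> Node l v Leaf) = T"
      using T ne[of v] by (auto simp: lbsts_def)
  qed auto
  finally show ?thesis by simp
qed

text \<open>A root with a single subtree carries it on the left or on the right according to how its
  label compares with that of the subtree's root, so that label and subtree are unconstrained.\<close>

lemma (in strict_linear_order) spineless_sum_add:
  assumes "finite A" "card A \<ge> 2"
  shows "b * spineless_sum R a b A + a * spineless_sum R\<inverse>\<inverse> b a A =
    a * b * (\<Sum>v\<in>A. tree_sum R a b (A - {v}))"
proof -
  have ne: "A - {v} \<noteq> {}" for v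
    using assms by (rule Diff_singleton_ne)
  let ?lt = "\<lambda>v. {l \<in> lbsts R (A - {v}). R (value l) v}"
  let ?gt = "\<lambda>v. {l \<in> lbsts R (A - {v}). R v (value l)}"
  \<comment> \<open>Mirroring turns trees for the converse order into trees for \<open>R\<close> and
    swaps the weights, so this sum covers the root labels above \<open>v\<close>.\<close>
  have mir: "(\<Sum>l\<in>{l \<in> lbsts R\<inverse>\<inverse> (A - {v}). R\<inverse>\<inverse> (value l) v}. b * edge_weight b a l) =
      (\<Sum>l\<in>?gt v. b * edge_weight a b l)" for v
  proof (rule sum.reindex_bij_witness[of _ mirror mirror])
    fix l assume l: "l \<in> {l \<in> lbsts R\<inverse>\<inverse> (A - {v}). R\<inverse>\<inverse> (value l) v}"
    then have "l \<noteq> Leaf" using ne[of v] by auto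
    then show "mirror l \<in> ?gt v" using l by (simp add: mirror_in_lbsts_iff)
  next
    fix l assume l: "l \<in> ?gt v"
    then have "l \<noteq> Leaf" using ne[of v] by auto
    then show "mirror l \<in> {l \<in> lbsts R\<inverse>\<inverse> (A - {v}). R\<inverse>\<inverse> (value l) v}"
      using l by (simp add: mirror_in_lbsts_iff)
  qed (auto simp: edge_weight_mirror)
  have un: "tree_sum R a b (A - {v}) = (\<Sum>l\<in>?lt v. edge_weight a b l) + (\<Sum>l\<in>?gt v. edge_weight a b l)" for v
  proof -
    have "lbsts R (A - {v}) = ?lt v \<union> ?gt v"
    proof -
      have "R v (value l) \<or> R (value l) v" if "l \<in> lbsts R (A - {v})" for l
      proof -
        have "l \<noteq> Leaf" using that ne[of v] by auto
        then have "value l \<in> A - {v}" using that value_in_set_tree[of l] by (auto simp: lbsts_def)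
        then show ?thesis using total[of v "value l"] by auto
      qed
      then show ?thesis by auto
    qed
    moreover have "?lt v \<inter> ?gt v = {}" using asym by auto
    ultimately show ?thesis
      unfolding tree_sum_def using assms finite_lbsts[of "A - {v}" R]
      by (metis (no_types, lifting) finite_Diff finite_Un sum.union_disjoint)
  qed
  show ?thesis
    unfolding spineless_sum_eq[OF assms] mir un
    by (simp add: sum_distrib_left sum.distrib algebra_simps)
qed

section \<open>Relabelling along order isomorphisms\<close>

lemma lbst_wrt_map_tree:
  assumes "\<And>x y. x \<in> set_tree T \<Longrightarrow> y \<in> set_tree T \<Longrightarrow> R (h x) (h y) \<longleftrightarrow> R' x y"
  shows "lbst_wrt R (map_tree h T) \<longleftrightarrow> lbst_wrt R' T"
  using assms
proof (induction T)
  case (Node l v r)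
  have "value (map_tree h s) = h (value s)" if "s \<noteq> Leaf" for s using that by (cases s) auto
  then show ?case using Node value_in_set_tree[of l] value_in_set_tree[of r] by auto
qed auto

lemma right_edges_map_tree [simp]: "right_edges (map_tree h T) = right_edges T"
  by (induction T) auto

lemma edge_weight_map_tree [simp]: "edge_weight a b (map_tree h T) = edge_weight a b T"
  by (simp add: edge_weight_def flip: map_mirror)

lemma map_tree_in_lbsts:
  assumes "T \<in> lbsts R' A" "bij_betw h A B"
    and "\<And>x y. x \<in> A \<Longrightarrow> y \<in> A \<Longrightarrow> R (h x) (h y) \<longleftrightarrow> R' x y"
  shows "map_tree h T \<in> lbsts R B"
  using assms lbst_wrt_map_tree[of T R h R']
  by (auto simp: lbsts_def bij_betw_def inorder_map distinct_map tree.set_map)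

lemma bij_betw_map_tree_lbsts:
  assumes h: "bij_betw h A B" and R: "\<And>x y. x \<in> A \<Longrightarrow> y \<in> A \<Longrightarrow> R (h x) (h y) \<longleftrightarrow> R' x y"
  shows "bij_betw (map_tree h) (lbsts R' A) (lbsts R B)"
proof (rule bij_betw_byWitness[of _ "map_tree (inv_into A h)"])
  have inv: "bij_betw (inv_into A h) B A" using h by (rule bij_betw_inv_into)
  have R': "R' (inv_into A h x) (inv_into A h y) \<longleftrightarrow> R x y" if "x \<in> B" "y \<in> B" for x y
    using that R[of "inv_into A h x" "inv_into A h y"] bij_betw_apply[OF inv]
      bij_betw_inv_into_right[OF h] by simp
  show "\<forall>T\<in>lbsts R' A. map_tree (inv_into A h) (map_tree h T) = T"
    using h by (auto simp: lbsts_def tree.map_comp bij_betw_inv_into_left intro!: trans[OF tree.map_cong tree.map_ident])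
  show "\<forall>T\<in>lbsts R B. map_tree h (map_tree (inv_into A h) T) = T"
    using h by (auto simp: lbsts_def tree.map_comp bij_betw_inv_into_right intro!: trans[OF tree.map_cong tree.map_ident])
  show "map_tree h ` lbsts R' A \<subseteq> lbsts R B"
    using map_tree_in_lbsts[where R = R and R' = R', OF _ h R] by blast
  show "map_tree (inv_into A h) ` lbsts R B \<subseteq> lbsts R' A"
    using map_tree_in_lbsts[where R = R' and R' = R, OF _ inv R'] by blast
qed

lemma tree_sum_relabel:
  assumes h: "bij_betw h A B" and R: "\<And>x y. x \<in> A \<Longrightarrow> y \<in> A \<Longrightarrow> R (h x) (h y) \<longleftrightarrow> R' x y"
  shows "tree_sum R a b B = tree_sum R' a b A"
  unfolding tree_sum_def
  using sum.reindex_bij_betw[OF bij_betw_map_tree_lbsts[where R = R and R' = R', OF assms],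
      of "edge_weight a b"] by simp

lemma spineless_sum_relabel:
  assumes h: "bij_betw h A B" and R: "\<And>x y. x \<in> A \<Longrightarrow> y \<in> A \<Longrightarrow> R (h x) (h y) \<longleftrightarrow> R' x y"
  shows "spineless_sum R a b B = spineless_sum R' a b A"
proof -
  have bij: "bij_betw (map_tree h) (lbsts R' A) (lbsts R B)"
    using assms by (rule bij_betw_map_tree_lbsts)
  have "right (map_tree h T) = Leaf \<longleftrightarrow> right T = Leaf" for T by (cases T) auto
  then have "bij_betw (map_tree h) {T \<in> lbsts R' A. T \<noteq> Leaf \<and> right T = Leaf}
      {T \<in> lbsts R B. T \<noteq> Leaf \<and> right T = Leaf}"
    using bij_betw_Collect[OF bij, of "\<lambda>T. T \<noteq> Leaf \<and> right T = Leaf"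
        "\<lambda>T. T \<noteq> Leaf \<and> right T = Leaf"] by simp
  from sum.reindex_bij_betw[OF this, of "edge_weight a b"] show ?thesis
    by (simp add: spineless_sum_def)
qed

section \<open>Generating functions\<close>

unbundle fps_syntax

lemma ex_order_iso_lessThan:
  fixes A :: "nat set"
  assumes "finite A"
  shows "\<exists>h. bij_betw h {..<card A} A \<and> (\<forall>x\<in>{..<card A}. \<forall>y\<in>{..<card A}. h x < h y \<longleftrightarrow> x < y)"
proof -
  obtain h where h: "bij_betw h {..<card A} A" "strict_mono_on {..<card A} h"
    using ex_bij_betw_strict_mono_card[OF assms] by (auto simp: atLeast0LessThan)
  show ?thesis
    using h strict_mono_on_less[OF h(2)] by blast
qed

text \<open>A finite set of naturals is order isomorphic to an initial segment, and relabelling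
  preserves weights.\<close>

lemma tree_sum_card:
  fixes A :: "nat set"
  assumes "finite A"
  shows "tree_sum (<) a b A = tree_sum (<) a b {..<card A}"
proof -
  obtain h where h: "bij_betw h {..<card A} A"
    "\<forall>x\<in>{..<card A}. \<forall>y\<in>{..<card A}. h x < h y \<longleftrightarrow> x < y"
    using ex_order_iso_lessThan[OF assms(1)] by blast
  show ?thesis
    using h(2) by (intro tree_sum_relabel[OF h(1)]) auto
qed

lemma tree_sum_converse_card:
  "finite A \<Longrightarrow> tree_sum (<)\<inverse>\<inverse> a b A = tree_sum (<)\<inverse>\<inverse> a b {..<card A}" for A :: "nat set"
  unfolding tree_sum_mirror by (rule tree_sum_card)

lemma spineless_sum_card:
  fixes A :: "nat set"
  assumes "finite A" "R = (<) \<or> R = (<)\<inverse>\<inverse>"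
  shows "spineless_sum R a b A = spineless_sum R a b {..<card A}"
proof -
  obtain h where h: "bij_betw h {..<card A} A"
    "\<forall>x\<in>{..<card A}. \<forall>y\<in>{..<card A}. h x < h y \<longleftrightarrow> x < y"
    using ex_order_iso_lessThan[OF assms(1)] by blast
  show ?thesis
    using assms(2) h(2) by (intro spineless_sum_relabel[OF h(1)]) auto
qed

lemma sum_Pow_card:
  fixes f :: "nat \<Rightarrow> real"
  assumes "finite A"
  shows "(\<Sum>S\<in>Pow A. f (card S)) = (\<Sum>k\<le>card A. real (card A choose k) * f k)"
proof -
  have "(\<Sum>S\<in>Pow A. f (card S)) = (\<Sum>k\<le>card A. \<Sum>S\<in>{S \<in> Pow A. card S = k}. f (card S))"
    by (rule sum.group[symmetric]) (use assms card_mono in auto)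
  also have "\<dots> = (\<Sum>k\<le>card A. real (card A choose k) * f k)"
    by (simp add: n_subsets assms)
  finally show ?thesis .
qed

text \<open>This is B. The empty tree is excluded by the value 0 at \<open>n = 0\<close>, so that 1
  + b B counts possibly empty right subtrees with their connecting edge.\<close>

definition tree_fps :: "(nat \<Rightarrow> nat \<Rightarrow> bool) \<Rightarrow> real \<Rightarrow> real \<Rightarrow> real fps" where
  "tree_fps R a b = Abs_fps (\<lambda>n. if n = 0 then 0 else tree_sum R a b {..<n} / fact n)"

definition spineless_fps :: "(nat \<Rightarrow> nat \<Rightarrow> bool) \<Rightarrow> real \<Rightarrow> real \<Rightarrow> real fps" where
  "spineless_fps R a b = Abs_fps (\<lambda>n. spineless_sum R a b {..<n} / fact n)"

lemma tree_fps_mirror: "tree_fps R\<inverse>\<inverse> a b = tree_fps R b a"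
  unfolding tree_fps_def tree_sum_mirror ..

text \<open>Differentiation marks one label, here \<open>n\<close>, and the spine piece containing
  it is cut out. This is the differential form of 1 + b B = exp (b G), for which removing a single
  piece suffices.\<close>

lemma fps_deriv_tree_fps:
  assumes R: "R = (<) \<or> R = (<)\<inverse>\<inverse>"
  shows "fps_deriv (tree_fps R a b) =
    fps_deriv (spineless_fps R a b) * (1 + fps_const b * tree_fps R a b)"
proof (rule fps_ext)
  fix n
  interpret strict_linear_order R
    using R strict_linear_order_less strict_linear_order.converse by blast
  let ?g = "\<lambda>n. spineless_sum R a b {..<n}" and ?c = "\<lambda>n. attached_sum R a b {..<n}"
  have c: "attached_sum R a b A = ?c (card A)" if "finite A" for A
    using R tree_sum_card[OF that] tree_sum_converse_card[OF that] that
    by (cases "A = {}") (auto simp: attached_sum_eq lessThan_empty_iff)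
  have c': "(1 + fps_const b * tree_fps R a b) $ k = ?c k / fact k" for k
    by (simp add: tree_fps_def attached_sum_eq lessThan_empty_iff)
  have "tree_sum R a b {..<Suc n} =
      (\<Sum>S | S \<subseteq> {..<Suc n} \<and> n \<in> S. spineless_sum R a b S * attached_sum R a b ({..<Suc n} - S))"
    by (rule tree_sum_by_spine) auto
  \<comment> \<open>Sets containing \<open>n\<close> correspond to subsets of \<open>{..<n}\<close>,
    and both sums depend only on cardinalities.\<close>
  also have "\<dots> = (\<Sum>S\<in>Pow {..<n}. ?g (Suc (card S)) * ?c (n - card S))"
  proof (rule sum.reindex_bij_witness[of _ "insert n" "\<lambda>S. S - {n}"])
    fix S assume "S \<in> {S. S \<subseteq> {..<Suc n} \<and> n \<in> S}"
    then have S: "S \<subseteq> {..<Suc n}" "n \<in> S" "finite S" using finite_subset by auto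
    then have card: "card S = Suc (card (S - {n}))"
      by (metis card_Suc_Diff1)
    then have "card ({..<Suc n} - S) = n - card (S - {n})"
      using S by (simp add: card_Diff_subset)
    with S card show "?g (Suc (card (S - {n}))) * ?c (n - card (S - {n})) =
        spineless_sum R a b S * attached_sum R a b ({..<Suc n} - S)"
      using spineless_sum_card[OF _ R, of S] c[of "{..<Suc n} - S"] by simp
  qed auto
  also have "\<dots> = (\<Sum>k\<le>n. real (n choose k) * (?g (Suc k) * ?c (n - k)))"
    using sum_Pow_card[of "{..<n}" "\<lambda>k. ?g (Suc k) * ?c (n - k)"] by simp
  finally have rec: "tree_sum R a b {..<Suc n} = \<dots>" .
  have "(fps_deriv (spineless_fps R a b) * (1 + fps_const b * tree_fps R a b)) $ n =
      (\<Sum>k\<le>n. (?g (Suc k) / fact k) * (?c (n - k) / fact (n - k)))"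
    unfolding fps_mult_nth c' by (simp add: spineless_fps_def fps_deriv_nth atLeast0AtMost)
  also have "\<dots> = tree_sum R a b {..<Suc n} / fact n"
    unfolding rec sum_divide_distrib by (intro sum.cong refl) (simp add: binomial_fact)
  also have "\<dots> = fps_deriv (tree_fps R a b) $ n"
    by (simp add: tree_fps_def fps_deriv_nth)
  finally show "fps_deriv (tree_fps R a b) $ n =
    (fps_deriv (spineless_fps R a b) * (1 + fps_const b * tree_fps R a b)) $ n" by simp
qed

lemma lbsts_singleton: "lbsts R {v} = {Node Leaf v Leaf}"
proof -
  have "T = Node Leaf v Leaf" if "T \<in> lbsts R {v}" for T
    using that by (cases T) (auto simp: lbsts_def subset_singleton_iff)
  then show ?thesis by (auto simp: lbsts_def)
qed

text \<open>For at least two labels, the \<open>n\<close> choices of the root label turn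
  \<open>1 / fact n\<close> into \<open>1 / fact (n - 1)\<close>, a shift by x. The single node is
  counted by both G and H, which gives the constant a + b.\<close>

lemma spineless_fps_add:
  "fps_const b * spineless_fps (<) a b + fps_const a * spineless_fps (<)\<inverse>\<inverse> b a =
    fps_X * (fps_const (a + b) + fps_const (a * b) * tree_fps (<) a b)"
proof (rule fps_ext)
  fix n
  interpret strict_linear_order "(<) :: nat \<Rightarrow> nat \<Rightarrow> bool" by (rule strict_linear_order_less)
  show "(fps_const b * spineless_fps (<) a b + fps_const a * spineless_fps (<)\<inverse>\<inverse> b a) $ n =
      (fps_X * (fps_const (a + b) + fps_const (a * b) * tree_fps (<) a b)) $ n"
  proof (cases "n \<ge> 2")
    case True
    then obtain m where m: "n = Suc m" "m \<noteq> 0" by (cases n) auto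
    define g h where "g = spineless_sum (<) a b {..<n}" and "h = spineless_sum (<)\<inverse>\<inverse> b a {..<n}"
    have "b * g + a * h = a * b * (\<Sum>v\<in>{..<n}. tree_sum (<) a b ({..<n} - {v}))"
      unfolding g_def h_def using True by (intro spineless_sum_add) auto
    also have "(\<Sum>v\<in>{..<n}. tree_sum (<) a b ({..<n} - {v})) = real n * tree_sum (<) a b {..<m}"
      by (subst tree_sum_card) (auto simp: m)
    finally have "(b * g + a * h) / fact n =
        a * b * (tree_sum (<) a b {..<m} / fact m)"
      by (simp add: m field_simps del: of_nat_Suc)
    then show ?thesis
      unfolding g_def h_def spineless_fps_def using m
      by (simp add: tree_fps_def add_divide_distrib)
  next
    case False
    have "{T \<in> lbsts R {0}. T \<noteq> Leaf \<and> right T = Leaf} = {Node Leaf 0 Leaf}"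
      "{T \<in> lbsts R {}. T \<noteq> Leaf \<and> right T = Leaf} = {}" for R :: "nat \<Rightarrow> nat \<Rightarrow> bool"
      unfolding lbsts_singleton by auto
    then have "spineless_sum R a b {..<Suc 0} = 1" "spineless_sum R a b {} = 0"
      for R :: "nat \<Rightarrow> nat \<Rightarrow> bool" and a b
      unfolding spineless_sum_def by (simp_all add: lessThan_Suc)
    moreover have "n = 0 \<or> n = 1" using False by auto
    ultimately show ?thesis by (auto simp: spineless_fps_def tree_fps_def)
  qed
qed

section \<open>The exponential equation and its solution\<close>

lemma fps_exp_compose_unique:
  fixes E F :: "real fps"
  assumes "fps_deriv E = fps_deriv F * E" "E $ 0 = 1" "F $ 0 = 0"
  shows "E = fps_exp 1 oo F"
proof -
  have deriv: "fps_deriv (fps_exp c oo F) = fps_const c * fps_deriv F * (fps_exp c oo F)" for c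
    using assms(3) by (simp add: fps_compose_deriv fps_compose_mult_distrib mult_ac)
  \<comment> \<open>The product of a solution with exp (-F) has derivative 0 and constant term 1;
    this applies to \<open>E\<close> and to exp F alike.\<close>
  have one: "E' * (fps_exp (-1) oo F) = 1"
    if "fps_deriv E' = fps_deriv F * E'" "E' $ 0 = 1" for E'
  proof -
    have "fps_deriv (E' * (fps_exp (-1) oo F)) = 0"
      by (simp add: deriv that(1) algebra_simps flip: fps_const_neg)
    then have "E' * (fps_exp (-1) oo F) = fps_const ((E' * (fps_exp (-1) oo F)) $ 0)"
      by (rule iffD1[OF fps_deriv_eq_0_iff])
    then show ?thesis using that(2) by simp
  qed
  have "E * (fps_exp (-1) oo F) = (fps_exp 1 oo F) * (fps_exp (-1) oo F)"
    using one[OF assms(1,2)] one[of "fps_exp 1 oo F"] deriv[of 1] by simp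
  moreover have "fps_exp (-1) oo F \<noteq> 0" using one[OF assms(1,2)] by force
  ultimately show ?thesis by simp
qed

text \<open>These are the coefficients of B = x Q(x y), where Q(z) = (exp z - 1) / z. Only
  coefficients of y, hence of B, of index at most \<open>n\<close> occur on the right, so this is a
  recursion.\<close>

lemma tree_fps_nth_Suc:
  fixes a b :: real
  defines "y \<equiv> fps_const (a + b) + fps_const (a * b) * tree_fps (<) a b"
  assumes "y \<noteq> 0"
  shows "tree_fps (<) a b $ Suc n = (\<Sum>i\<le>n. (y ^ i) $ (n - i) / fact (Suc i))"
proof -
  let ?B = "tree_fps (<) a b" and ?G = "spineless_fps (<) a b" and ?H = "spineless_fps (<)\<inverse>\<inverse> b a"
  define F where "F = fps_X * y"
  define E where "E = (1 + fps_const a * ?B) * (1 + fps_const b * ?B)"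
  \<comment> \<open>The second equation is the first one for the converse order and exchanged
    weights; by mirroring, its series is B again.\<close>
  have dB: "fps_deriv ?B = fps_deriv ?G * (1 + fps_const b * ?B)"
    "fps_deriv ?B = fps_deriv ?H * (1 + fps_const a * ?B)"
    using fps_deriv_tree_fps[of "(<)" a b] fps_deriv_tree_fps[of "(<)\<inverse>\<inverse>" b a]
    by (simp_all add: tree_fps_mirror)
  have "F = fps_const b * ?G + fps_const a * ?H"
    unfolding F_def y_def spineless_fps_add ..
  then have "fps_deriv F = fps_const b * fps_deriv ?G + fps_const a * fps_deriv ?H"
    by simp
  moreover have "fps_deriv E = fps_const a * fps_deriv ?B * (1 + fps_const b * ?B) +
      fps_const b * fps_deriv ?B * (1 + fps_const a * ?B)"
    unfolding E_def by (simp add: algebra_simps)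
  \<comment> \<open>Substitute B' = H' (1 + a B) in a B' (1 + b B) and B' = G' (1 + b B) in b B' (1
    + a B).\<close>
  ultimately have "fps_deriv E = fps_deriv F * E"
    unfolding E_def using dB by algebra
  moreover have B0: "?B $ 0 = 0" by (simp add: tree_fps_def)
  moreover have "E $ 0 = 1" by (simp add: E_def B0)
  moreover have "F $ 0 = 0" by (simp add: F_def)
  ultimately have E: "E = fps_exp 1 oo F" by (intro fps_exp_compose_unique)
  define Q :: "real fps" where "Q = Abs_fps (\<lambda>n. 1 / fact (Suc n))"
  have "fps_exp 1 = 1 + Q * fps_X"
    by (rule fps_ext) (auto simp: Q_def fact_reduce)
  then have "E = 1 + (Q oo F) * F"
    using E \<open>F $ 0 = 0\<close> by (simp add: fps_compose_add_distrib fps_compose_mult_distrib fps_X_fps_compose_startby0)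
  moreover have "E = 1 + y * ?B"
    unfolding E_def y_def by (simp add: algebra_simps flip: fps_const_add fps_const_mult)
  ultimately have "y * ?B = y * (fps_X * (Q oo F))"
    by (simp add: F_def mult_ac)
  then have "?B = fps_X * (Q oo F)"
    using assms by simp
  then have "?B $ Suc n = (Q oo F) $ n" by simp
  also have "\<dots> = (\<Sum>i\<le>n. (y ^ i) $ (n - i) / fact (Suc i))"
    by (simp add: fps_compose_nth F_def Q_def power_mult_distrib atLeast0AtMost fps_X_power_mult_nth del: fact_Suc)
  finally show ?thesis .
qed

section \<open>Nonnegativity and unimodality\<close>

text \<open>This is a predicate on functions of \<open>t\<close> because the power series are formed separately
  for each real \<open>t\<close>; \<open>d\<close> is only an upper bound for the degree.\<close>

inductive gamma_cone :: "nat \<Rightarrow> (real \<Rightarrow> real) \<Rightarrow> bool" for d where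
  zero: "gamma_cone d (\<lambda>t. 0)"
| add_term: "gamma_cone d f \<Longrightarrow> 0 \<le> c \<Longrightarrow> 2 * j \<le> d \<Longrightarrow>
    gamma_cone d (\<lambda>t. f t + c * (t ^ j * (1 + t) ^ (d - 2 * j)))"

lemma gamma_cone_add: "gamma_cone d g \<Longrightarrow> gamma_cone d f \<Longrightarrow> gamma_cone d (\<lambda>t. f t + g t)"
  by (induction rule: gamma_cone.induct) (auto simp: add.assoc[symmetric] intro: gamma_cone.add_term)

lemma gamma_cone_scale: "gamma_cone d f \<Longrightarrow> 0 \<le> c \<Longrightarrow> gamma_cone d (\<lambda>t. c * f t)"
proof (induction rule: gamma_cone.induct)
  case (add_term f c' j)
  then have "gamma_cone d (\<lambda>t. c * f t + (c * c') * (t ^ j * (1 + t) ^ (d - 2 * j)))"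
    by (intro gamma_cone.add_term) auto
  then show ?case by (simp add: algebra_simps)
qed (auto intro: gamma_cone.zero)

lemma gamma_cone_sum: "(\<And>i. i \<in> I \<Longrightarrow> gamma_cone d (f i)) \<Longrightarrow> gamma_cone d (\<lambda>t. \<Sum>i\<in>I. f i t)"
  by (induction I rule: infinite_finite_induct) (auto intro: gamma_cone.zero gamma_cone_add)

lemma gamma_cone_term: "2 * j \<le> d \<Longrightarrow> gamma_cone d (\<lambda>t. t ^ j * (1 + t) ^ (d - 2 * j))"
  using gamma_cone.add_term[OF gamma_cone.zero, of 1 j d] by simp

text \<open>The basic terms of indices j for \<open>d\<close> and i for \<open>e\<close> multiply to
  the basic term of index j + i for \<open>d + e\<close>; the bounds on the indices make the
  subtractions exact.\<close>

lemma gamma_cone_mult_term: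
  "gamma_cone d f \<Longrightarrow> 2 * i \<le> e \<Longrightarrow> gamma_cone (d + e) (\<lambda>t. f t * (t ^ i * (1 + t) ^ (e - 2 * i)))"
proof (induction rule: gamma_cone.induct)
  case (add_term f c j)
  have eq: "d + e - 2 * (j + i) = (d - 2 * j) + (e - 2 * i)" using add_term by auto
  have "gamma_cone (d + e) (\<lambda>t. f t * (t ^ i * (1 + t) ^ (e - 2 * i)) +
      c * (t ^ (j + i) * (1 + t) ^ (d + e - 2 * (j + i))))"
    using add_term by (intro gamma_cone.add_term) auto
  then show ?case unfolding eq by (simp add: algebra_simps power_add)
qed (auto intro: gamma_cone.zero)

lemma gamma_cone_mult:
  "gamma_cone e g \<Longrightarrow> gamma_cone d f \<Longrightarrow> gamma_cone (d + e) (\<lambda>t. f t * g t)"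
proof (induction rule: gamma_cone.induct)
  case (add_term g c j)
  then have "gamma_cone (d + e) (\<lambda>t. f t * g t + c * (f t * (t ^ j * (1 + t) ^ (e - 2 * j))))"
    by (intro gamma_cone_add gamma_cone_scale gamma_cone_mult_term) auto
  then show ?case by (simp add: algebra_simps)
qed (auto intro: gamma_cone.zero)

lemma gamma_cone_expansion:
  "gamma_cone d f \<Longrightarrow>
    \<exists>\<gamma>. (\<forall>j. 0 \<le> \<gamma> j) \<and> (\<forall>t. f t = (\<Sum>j\<le>d div 2. \<gamma> j * (t ^ j * (1 + t) ^ (d - 2 * j))))"
proof (induction rule: gamma_cone.induct)
  case zero
  then show ?case by (intro exI[of _ "\<lambda>_. 0"]) simp
next
  case (add_term f c i)
  then obtain \<gamma> where g: "\<forall>j. 0 \<le> \<gamma> j"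
    "\<And>t. f t = (\<Sum>j\<le>d div 2. \<gamma> j * (t ^ j * (1 + t) ^ (d - 2 * j)))" by blast
  have "i \<le> d div 2" using add_term by simp
  then show ?case using g add_term
    by (intro exI[of _ "\<lambda>j. \<gamma> j + (if j = i then c else 0)"])
      (simp add: distrib_right sum.distrib if_distrib[of "\<lambda>x. x * _"] cong: if_cong)
qed

section \<open>The specialization a = 1, b = t\<close>

definition lbst_fps :: "real \<Rightarrow> real fps" where
  "lbst_fps t = tree_fps (<) 1 t"

text \<open>This is the series y at a = 1, b = t.\<close>

definition step_fps :: "real \<Rightarrow> real fps" where
  "step_fps t = fps_const (1 + t) + fps_const t * lbst_fps t"

lemma lbst_fps_0 [simp]: "lbst_fps t $ 0 = 0"
  by (simp add: lbst_fps_def tree_fps_def)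

text \<open>The constant coefficient 1 + t and the linear coefficient t cannot both vanish.\<close>

lemma step_fps_ne_0: "step_fps t \<noteq> 0"
proof
  assume "step_fps t = 0"
  then have "step_fps t $ 0 = 0" "step_fps t $ 1 = 0" by simp_all
  then show False
    by (simp add: step_fps_def lbst_fps_def tree_fps_def tree_sum_def lessThan_Suc lbsts_singleton)
qed

lemma lbst_fps_nth_Suc: "lbst_fps t $ Suc n = (\<Sum>i\<le>n. (step_fps t ^ i) $ (n - i) / fact (Suc i))"
  using tree_fps_nth_Suc[of 1 t n] step_fps_ne_0[of t] unfolding step_fps_def lbst_fps_def by simp

text \<open>Each factor has a degree bound one above its index, so \<open>i\<close> factors with
  indices adding up to \<open>k\<close> have the bound \<open>k + i\<close>.\<close>

lemma gamma_cone_step_power: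
  assumes "\<And>k. k \<le> n \<Longrightarrow> gamma_cone (k + 1) (\<lambda>t. step_fps t $ k)" "k \<le> n"
  shows "gamma_cone (k + i) (\<lambda>t. (step_fps t ^ i) $ k)"
  using assms(2)
proof (induction i arbitrary: k)
  case 0
  show ?case
    using gamma_cone_term[of 0 0] gamma_cone.zero by (cases "k = 0") auto
next
  case (Suc i)
  have "gamma_cone (k + Suc i) (\<lambda>t. step_fps t $ j * (step_fps t ^ i) $ (k - j))" if "j \<le> k" for j
  proof -
    have "gamma_cone ((j + 1) + (k - j + i)) (\<lambda>t. step_fps t $ j * (step_fps t ^ i) $ (k - j))"
      using that Suc.prems by (intro gamma_cone_mult assms(1) Suc.IH) auto
    then show ?thesis using that by simp
  qed
  then show ?case by (auto simp: fps_mult_nth intro!: gamma_cone_sum)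
qed

text \<open>The coefficient of y at m + 1 is t times that of B, and t lies in the cone for 2, which
  gives the bound m + 2. In the recursion every summand then has the same bound (n - i) + i = n, so
  the sum stays in the cone.\<close>

lemma gamma_cone_lbst_fps: "gamma_cone n (\<lambda>t. lbst_fps t $ Suc n)"
proof (induction n rule: less_induct)
  case (less n)
  have step: "gamma_cone (k + 1) (\<lambda>t. step_fps t $ k)" if "k \<le> n" for k
  proof (cases k)
    case 0
    then show ?thesis using gamma_cone_term[of 0 1] by (simp add: step_fps_def)
  next
    case (Suc m)
    then have "gamma_cone (m + 2) (\<lambda>t. lbst_fps t $ Suc m * t)"
      using less[of m] gamma_cone_term[of 1 2] that by (intro gamma_cone_mult) auto
    then show ?thesis using Suc by (simp add: step_fps_def mult.commute)
  qed
  have "gamma_cone n (\<lambda>t. 1 / fact (Suc i) * (step_fps t ^ i) $ (n - i))" if "i \<le> n" for i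
    using gamma_cone_step_power[of n "n - i" i] step that by (intro gamma_cone_scale) auto
  then show ?case
    unfolding lbst_fps_nth_Suc by (intro gamma_cone_sum) auto
qed

lemma poly_local_bst_poly:
  assumes "n \<ge> 1"
  shows "poly (local_bst_poly n) t = fact n * lbst_fps t $ n"
proof -
  have "poly (local_bst_poly n) t = tree_sum (<) 1 t {1..n}"
    unfolding local_bst_poly_def tree_sum_def standard_local_bsts_eq poly_sum
    by (simp add: edge_weight_def poly_monom)
  also have "\<dots> = tree_sum (<) 1 t {..<n}"
    by (subst tree_sum_card) auto
  finally show ?thesis using assms by (simp add: lbst_fps_def tree_fps_def)
qed

section \<open>Degrees and coefficients of gamma expansions\<close>

lemma coeff_gamma_term:
  "coeff (monom c j * [:1, 1:] ^ m) i = (if i < j then 0 else c * real (m choose (i - j)))"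
  for c :: real
proof -
  have "coeff ([:1, 1:] ^ m) k = real (m choose k)" for k
  proof -
    have "[:1, 1:] = 1 + monom (1::real) 1" by (simp add: monom_altdef one_pCons)
    then have "[:1, 1:] ^ m = (\<Sum>k\<le>m. monom (real (m choose k)) k)"
      by (simp add: add.commute[of _ "monom _ _"] binomial_ring monom_power of_nat_poly smult_monom)
    then show ?thesis by (simp add: coeff_sum)
  qed
  then show ?thesis by (simp add: coeff_monom_mult not_le)
qed

text \<open>The term of index j has degree at most d - j, so only j = 0 reaches t^d; positivity of
  \<open>\<gamma> 0\<close> thus makes \<open>d\<close> the true degree.\<close>

lemma gamma_nonnegI:
  assumes "\<And>j. 0 \<le> \<gamma> j" "0 < \<gamma> 0"
    and p: "p = (\<Sum>j\<le>d div 2. monom (\<gamma> j) j * [:1, 1:] ^ (d - 2 * j))"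
  shows "gamma_nonneg p" "degree p = d"
proof -
  have c: "coeff p i = (\<Sum>j\<le>d div 2. if i < j then 0 else \<gamma> j * real (d - 2 * j choose (i - j)))" for i
    unfolding p coeff_sum coeff_gamma_term ..
  have "coeff p d = (\<Sum>j\<le>d div 2. if j = 0 then \<gamma> 0 else 0)"
    unfolding c by (intro sum.cong refl) (auto simp: binomial_eq_0)
  then have "coeff p d = \<gamma> 0" by simp
  moreover have "coeff p i = 0" if "i > d" for i
    unfolding c by (intro sum.neutral) (use that in \<open>auto simp: binomial_eq_0\<close>)
  ultimately show d: "degree p = d"
    using assms(2) by (metis degree_le le_degree order_antisym order_less_irrefl)
  have "p \<noteq> 0" using \<open>coeff p d = \<gamma> 0\<close> assms(2) by auto
  then show "gamma_nonneg p"
    unfolding gamma_nonneg_def d using p assms(1) by (intro conjI exI[of _ \<gamma>]) auto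
qed

lemma gamma_nonneg_local_bst_poly:
  assumes "n \<ge> 1"
  shows "gamma_nonneg (local_bst_poly n)"
proof -
  obtain d where n: "n = Suc d" using assms by (cases n) auto
  have "poly (local_bst_poly n) = (\<lambda>t. fact n * lbst_fps t $ Suc d)"
    using poly_local_bst_poly[OF assms] n by auto
  then have "gamma_cone d (poly (local_bst_poly n))"
    using gamma_cone_scale[OF gamma_cone_lbst_fps[of d], of "fact n"] by simp
  then obtain \<gamma> where g: "\<forall>j. 0 \<le> \<gamma> j"
    "\<And>t. poly (local_bst_poly n) t = (\<Sum>j\<le>d div 2. \<gamma> j * (t ^ j * (1 + t) ^ (d - 2 * j)))"
    using gamma_cone_expansion by blast
  then have "poly (local_bst_poly n) = poly (\<Sum>j\<le>d div 2. monom (\<gamma> j) j * [:1, 1:] ^ (d - 2 * j))"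
    by (intro ext) (simp add: poly_sum poly_monom mult.assoc)
  then have p: "local_bst_poly n = (\<Sum>j\<le>d div 2. monom (\<gamma> j) j * [:1, 1:] ^ (d - 2 * j))"
    by (simp add: poly_eq_poly_eq_iff)
  \<comment> \<open>The coefficient \<open>\<gamma> 0\<close> is the value at t = 0. There y = 1 and
    only the summand i = d of the recursion survives, which is positive.\<close>
  have "step_fps 0 = 1" by (simp add: step_fps_def)
  then have "lbst_fps 0 $ Suc d > 0"
    unfolding lbst_fps_nth_Suc by (intro sum_pos2[of _ d]) auto
  then have "poly (local_bst_poly n) 0 > 0"
    using poly_local_bst_poly[OF assms] n by simp
  moreover have "poly (local_bst_poly n) 0 = \<gamma> 0"
    unfolding g(2) by (subst sum.remove[of _ 0]) (auto intro!: sum.neutral)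
  ultimately show ?thesis using gamma_nonnegI[of \<gamma>] g(1) p by simp
qed

text \<open>All terms are symmetric about half the degree of \<open>p\<close>, and binomial
  coefficients increase up to the middle of their row.\<close>

lemma gamma_nonneg_coeff_mono:
  assumes "gamma_nonneg p" "i \<le> k" "k \<le> degree p div 2"
  shows "coeff p i \<le> coeff p k"
proof -
  obtain \<gamma> where g: "\<And>j. j \<le> degree p div 2 \<Longrightarrow> 0 \<le> \<gamma> j"
    "p = (\<Sum>j\<le>degree p div 2. monom (\<gamma> j) j * [:1, 1:] ^ (degree p - 2 * j))"
    using assms(1) by (auto simp: gamma_nonneg_def)
  show ?thesis
    unfolding arg_cong[OF g(2), of "\<lambda>p. coeff p _"] coeff_sum coeff_gamma_term
    by (intro sum_mono) (use assms g(1) in \<open>auto intro!: mult_left_mono binomial_mono\<close>)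
qed

text \<open>Past the common centre the binomial coefficients decrease; in odd degree the two middle
  ones agree, so the rounded-down half is a valid start.\<close>

lemma gamma_nonneg_coeff_antimono:
  assumes "gamma_nonneg p" "i \<le> k" "degree p div 2 \<le> i"
  shows "coeff p k \<le> coeff p i"
proof -
  obtain \<gamma> where g: "\<And>j. j \<le> degree p div 2 \<Longrightarrow> 0 \<le> \<gamma> j"
    "p = (\<Sum>j\<le>degree p div 2. monom (\<gamma> j) j * [:1, 1:] ^ (degree p - 2 * j))"
    using assms(1) by (auto simp: gamma_nonneg_def)
  have "(degree p - 2 * j choose (k - j)) \<le> (degree p - 2 * j choose (i - j))"
    if "j \<le> degree p div 2" for j
  proof (cases "k - j \<le> degree p - 2 * j")
    case True
    then show ?thesis using assms that by (intro binomial_antimono) auto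
  qed (simp add: binomial_eq_0)
  then show ?thesis
    unfolding arg_cong[OF g(2), of "\<lambda>p. coeff p _"] coeff_sum coeff_gamma_term
    by (intro sum_mono) (use assms g(1) in \<open>auto intro!: mult_left_mono\<close>)
qed

lemma unimodal_coeff_gamma_nonneg:
  assumes "gamma_nonneg p"
  shows "unimodal (coeff (monom 1 1 * p))"
proof -
  have nonneg: "0 \<le> coeff p i" for i
  proof (cases "i \<le> degree p div 2")
    case True
    obtain \<gamma> where g: "\<And>j. j \<le> degree p div 2 \<Longrightarrow> 0 \<le> \<gamma> j"
      "p = (\<Sum>j\<le>degree p div 2. monom (\<gamma> j) j * [:1, 1:] ^ (degree p - 2 * j))"
      using assms by (auto simp: gamma_nonneg_def)
    show ?thesis
      unfolding arg_cong[OF g(2), of "\<lambda>p. coeff p _"] coeff_sum coeff_gamma_term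
      by (intro sum_nonneg) (use g(1) in auto)
  next
    case False
    \<comment> \<open>The comparison is with an index beyond the degree, where the coefficient is
      0.\<close>
    have "coeff p (i + degree p + 1) \<le> coeff p i"
      using False by (intro gamma_nonneg_coeff_antimono[OF assms]) auto
    then show ?thesis by (simp add: coeff_eq_0)
  qed
  have c: "coeff (monom 1 1 * p) i = (if i = 0 then 0 else coeff p (i - 1))" for i
    by (simp add: coeff_monom_mult)
  show ?thesis
    unfolding unimodal_def c
  \<comment> \<open>The factor t moves the peak up by one; nonnegativity serves to compare with the
    new coefficient 0 at index 0.\<close>
  proof (intro exI[of _ "degree p div 2 + 1"] conjI monotone_onI)
    fix i k assume "i \<in> {..degree p div 2 + 1}" "k \<in> {..degree p div 2 + 1}" "i \<le> k"
    then show "(if i = 0 then 0 else coeff p (i - 1)) \<le> (if k = 0 then 0 else coeff p (k - 1))"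
      using nonneg gamma_nonneg_coeff_mono[OF assms, of "i - 1" "k - 1"] by auto
  next
    fix i k assume "i \<in> {degree p div 2 + 1..}" "k \<in> {degree p div 2 + 1..}" "i \<le> k"
    then show "(if k = 0 then 0 else coeff p (k - 1)) \<le> (if i = 0 then 0 else coeff p (i - 1))"
      using gamma_nonneg_coeff_antimono[OF assms, of "i - 1" "k - 1"] by auto
  qed
qed

section \<open>Splitting and joining trees at an edge\<close>

definition graph_conn :: "'a set set \<Rightarrow> ('a \<times> 'a) set" where
  "graph_conn E = {(x, y). {x, y} \<in> E}\<^sup>*"

lemma graph_conn_edge: "{x, y} \<in> E \<Longrightarrow> (x, y) \<in> graph_conn E"
  by (auto simp: graph_conn_def)

lemma graph_conn_refl [simp]: "(x, x) \<in> graph_conn E"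
  by (auto simp: graph_conn_def)

lemma graph_conn_trans: "(x, y) \<in> graph_conn E \<Longrightarrow> (y, z) \<in> graph_conn E \<Longrightarrow> (x, z) \<in> graph_conn E"
  unfolding graph_conn_def by (rule rtrancl_trans)

lemma graph_conn_step: "(x, y) \<in> graph_conn E \<Longrightarrow> {y, z} \<in> E \<Longrightarrow> (x, z) \<in> graph_conn E"
  using graph_conn_edge graph_conn_trans by metis

lemma graph_conn_sym: "(x, y) \<in> graph_conn E \<Longrightarrow> (y, x) \<in> graph_conn E"
proof -
  have "sym {(x, y). {x, y} \<in> E}" by (auto simp: sym_def insert_commute)
  then show "(x, y) \<in> graph_conn E \<Longrightarrow> (y, x) \<in> graph_conn E"
    unfolding graph_conn_def by (metis sym_rtrancl symD)
qed

lemma graph_conn_mono: "(x, y) \<in> graph_conn E \<Longrightarrow> E \<subseteq> E' \<Longrightarrow> (x, y) \<in> graph_conn E'"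
  unfolding graph_conn_def by (erule rtrancl_mono[THEN subsetD, rotated]) auto

lemma graph_conn_induct [consumes 1, case_names refl step]:
  assumes "(x, y) \<in> graph_conn E" "P x"
    "\<And>y z. (x, y) \<in> graph_conn E \<Longrightarrow> {y, z} \<in> E \<Longrightarrow> P y \<Longrightarrow> P z"
  shows "P y"
  using assms unfolding graph_conn_def
  by (induction rule: rtrancl_induct) auto

text \<open>Acyclicity by edge deletion, a form that suits cutting and joining at an edge better
  than lists of vertices.\<close>

definition all_bridges :: "'a set set \<Rightarrow> bool" where
  "all_bridges E \<longleftrightarrow> (\<forall>x y. {x, y} \<in> E \<longrightarrow> x \<noteq> y \<longrightarrow> (x, y) \<notin> graph_conn (E - {{x, y}}))"

lemma graph_conn_imp_path:
  assumes "(x, y) \<in> graph_conn E"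
  shows "\<exists>xs. xs \<noteq> [] \<and> hd xs = x \<and> last xs = y \<and> distinct xs \<and>
    (\<forall>i. Suc i < length xs \<longrightarrow> {xs ! i, xs ! Suc i} \<in> E)"
  using assms
proof (induction rule: graph_conn_induct)
  case refl
  then show ?case by (intro exI[of _ "[x]"]) auto
next
  case (step y z)
  then obtain xs where xs: "xs \<noteq> []" "hd xs = x" "last xs = y" "distinct xs"
    "\<And>i. Suc i < length xs \<Longrightarrow> {xs ! i, xs ! Suc i} \<in> E" by blast
  show ?case
  proof (cases "z \<in> set xs")
    case True
    then obtain k where k: "k < length xs" "xs ! k = z" by (auto simp: in_set_conv_nth)
    \<comment> \<open>The vertex \<open>z\<close> was visited before, and the path is cut back to
      that visit.\<close>
    show ?thesis
      using xs k by (intro exI[of _ "take (Suc k) xs"])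
        (auto simp: last_conv_nth hd_conv_nth)
  next
    case False
    have "{(xs @ [z]) ! i, (xs @ [z]) ! Suc i} \<in> E" if "Suc i < length (xs @ [z])" for i
    proof (cases "Suc i < length xs")
      case False
      then have "i = length xs - 1" "i < length xs" using that by auto
      then show ?thesis using xs step.hyps by (auto simp: nth_append last_conv_nth)
    qed (use xs in \<open>auto simp: nth_append\<close>)
    then show ?thesis using xs False by (intro exI[of _ "xs @ [z]"]) auto
  qed
qed

lemma graph_conn_nth:
  assumes "\<And>i. Suc i < length xs \<Longrightarrow> {xs ! i, xs ! Suc i} \<in> E" "k < length xs"
  shows "(xs ! 0, xs ! k) \<in> graph_conn E"
  using assms(2)
proof (induction k)
  case (Suc k)
  then show ?case using assms(1)[of k] graph_conn_step by fastforce
qed simp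

text \<open>A path joining the ends of an edge and avoiding it closes up to a cycle; conversely, the
  rest of a cycle bypasses the edge from its last to its first vertex.\<close>

lemma acyclic_iff_all_bridges: "\<not> (\<exists>xs. graph_cycle E xs) \<longleftrightarrow> all_bridges E"
proof
  assume acyc: "\<not> (\<exists>xs. graph_cycle E xs)"
  show "all_bridges E"
    unfolding all_bridges_def
  proof (intro allI impI notI)
    fix x y assume xy: "{x, y} \<in> E" "x \<noteq> y" "(x, y) \<in> graph_conn (E - {{x, y}})"
    obtain xs where xs: "xs \<noteq> []" "hd xs = x" "last xs = y" "distinct xs"
      "\<And>i. Suc i < length xs \<Longrightarrow> {xs ! i, xs ! Suc i} \<in> E - {{x, y}}"
      using graph_conn_imp_path[OF xy(3)] by blast
    have hl: "xs ! 0 = x" "xs ! (length xs - 1) = y"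
      using xs by (auto simp: hd_conv_nth last_conv_nth)
    \<comment> \<open>A single vertex would force \<open>x = y\<close>, and a path of two vertices
      would use the deleted edge.\<close>
    have len: "3 \<le> length xs"
    proof (rule ccontr)
      assume "\<not> 3 \<le> length xs"
      moreover have "length xs \<noteq> 0" using xs(1) by simp
      ultimately consider "length xs = 1" | "length xs = 2" by linarith
      then show False
        using hl xy(2) xs(5)[of 0] by cases auto
    qed
    have "graph_cycle E xs"
      unfolding graph_cycle_def
    proof (intro conjI allI impI)
      fix i assume i: "i < length xs"
      show "{xs ! i, xs ! (Suc i mod length xs)} \<in> E"
      proof (cases "Suc i < length xs")
        case False
        then have "Suc i = length xs" using i by auto
        then have "i = length xs - 1" "Suc i mod length xs = 0" by auto
        then show ?thesis using hl xy(1) by (simp add: insert_commute)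
      qed (use xs(5)[of i] in auto)
    qed (use len xs in auto)
    then show False using acyc by blast
  qed
next
  assume br: "all_bridges E"
  show "\<not> (\<exists>xs. graph_cycle E xs)"
  proof
    assume "\<exists>xs. graph_cycle E xs"
    then obtain xs where xs: "3 \<le> length xs" "distinct xs"
      "\<And>i. i < length xs \<Longrightarrow> {xs ! i, xs ! (Suc i mod length xs)} \<in> E"
      by (auto simp: graph_cycle_def)
    have "xs \<noteq> []" using xs(1) by auto
    define n where "n = length xs - 1"
    have n: "n < length xs" "Suc n = length xs" "2 \<le> n" using xs(1) by (auto simp: n_def)
    have e: "{xs ! 0, xs ! n} \<in> E" using xs(3)[OF n(1)] n(2) by (simp add: insert_commute)
    have ne: "xs ! 0 \<noteq> xs ! n" using n(1,3) xs(2) nth_eq_iff_index_eq[of xs 0 n] by linarith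
    have "{xs ! i, xs ! Suc i} \<in> E - {{xs ! 0, xs ! n}}" if i: "Suc i < length xs" for i
    proof -
      have "{xs ! i, xs ! Suc i} \<noteq> {xs ! 0, xs ! n}"
        using i n nth_eq_iff_index_eq[OF xs(2), of i 0] nth_eq_iff_index_eq[OF xs(2), of i n]
          nth_eq_iff_index_eq[OF xs(2), of "Suc i" 0] nth_eq_iff_index_eq[OF xs(2), of "Suc i" n] \<open>xs \<noteq> []\<close>
        by (auto simp: doubleton_eq_iff)
      then show ?thesis using xs(3)[of i] i by simp
    qed
    then have "(xs ! 0, xs ! n) \<in> graph_conn (E - {{xs ! 0, xs ! n}})"
      using n(1) by (rule graph_conn_nth)
    then show False using br e ne by (auto simp: all_bridges_def)
  qed
qed

lemma tree_graph_iff: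
  "tree_graph V E \<longleftrightarrow> simple_graph V E \<and> V \<noteq> {} \<and> (\<forall>u\<in>V. \<forall>v\<in>V. (u, v) \<in> graph_conn E) \<and> all_bridges E"
  unfolding tree_graph_def connected_graph_def acyclic_iff_all_bridges graph_conn_def
  by (simp only: conj_assoc)

lemma all_bridges_subset:
  assumes "all_bridges E" "E' \<subseteq> E"
  shows "all_bridges E'"
  unfolding all_bridges_def
proof (intro allI impI notI)
  fix x y assume "{x, y} \<in> E'" "x \<noteq> y" "(x, y) \<in> graph_conn (E' - {{x, y}})"
  moreover from this(3) have "(x, y) \<in> graph_conn (E - {{x, y}})"
    by (rule graph_conn_mono) (use assms(2) in auto)
  ultimately show False using assms by (auto simp: all_bridges_def)
qed

lemma simple_graph_edgeD:
  assumes "simple_graph V E" "{x, y} \<in> E"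
  shows "x \<in> V \<and> y \<in> V \<and> x \<noteq> y"
proof -
  have "{x, y} \<subseteq> V" "card {x, y} = 2"
    using assms unfolding simple_graph_def by (metis, metis)
  then show ?thesis by auto
qed

lemma simple_graph_edgeE:
  assumes "simple_graph V E" "e \<in> E"
  obtains x y where "e = {x, y}" "x \<noteq> y" "x \<in> V" "y \<in> V"
proof -
  have "e \<subseteq> V" "card e = 2" using assms by (auto simp: simple_graph_def)
  then obtain x y where "e = {x, y}" "x \<noteq> y" by (auto simp: card_2_iff)
  then show thesis using that \<open>e \<subseteq> V\<close> by auto
qed

lemma graph_conn_closed:
  assumes "(x, y) \<in> graph_conn E" "x \<in> W"
    "\<And>u v. {u, v} \<in> E \<Longrightarrow> u \<in> W \<Longrightarrow> v \<in> W"
  shows "y \<in> W"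
  using assms(1) by (induction rule: graph_conn_induct) (use assms in auto)

lemma tree_graph_singleton: "tree_graph {v} E \<longleftrightarrow> E = {}"
proof
  assume "tree_graph {v} E"
  then have "simple_graph {v} E" by (simp add: tree_graph_def)
  then have "e \<notin> E" for e by (auto elim!: simple_graph_edgeE)
  then show "E = {}" by blast
qed (simp add: tree_graph_iff simple_graph_def all_bridges_def)

text \<open>The edges of \<open>F\<close> lie inside \<open>W\<close>, so a walk starting in
  \<open>V\<close> never meets one.\<close>

lemma graph_conn_Un_disjoint:
  assumes "simple_graph V E" "simple_graph W F" "V \<inter> W = {}" "x \<in> V"
    "(x, y) \<in> graph_conn (E' \<union> F)" "E' \<subseteq> E"
  shows "y \<in> V \<and> (x, y) \<in> graph_conn E'"
  using assms(5)
proof (induction rule: graph_conn_induct)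
  case (step y z)
  then have "{y, z} \<in> E'" using simple_graph_edgeD[OF assms(2), of y z] assms(3) by auto
  then show ?case
    using step simple_graph_edgeD[OF assms(1), of y z] assms(6) graph_conn_step[of x y E' z] by auto
qed (use assms in auto)

text \<open>Without the new edge the two sides are disconnected. If an old edge is deleted, an
  excursion into the other tree leaves and returns at the same vertex, so it cannot replace that
  edge.\<close>

lemma tree_graph_join:
  assumes E: "tree_graph V E" and F: "tree_graph W F" and disj: "V \<inter> W = {}"
    and "p \<in> V" "c \<in> W"
  shows "tree_graph (V \<union> W) (insert {p, c} (E \<union> F))"
proof -
  let ?G = "insert {p, c} (E \<union> F)"
  have sE: "simple_graph V E" and sF: "simple_graph W F" using E F by (auto simp: tree_graph_def)
  have disj': "W \<inter> V = {}" using disj by auto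
  have pc: "p \<noteq> c" using assms by auto
  have pcEF: "{p, c} \<notin> E \<union> F"
    using simple_graph_edgeD[OF sE, of p c] simple_graph_edgeD[OF sF, of p c] assms by auto
  have "simple_graph (V \<union> W) ?G"
    using sE sF assms(4,5) pc by (auto simp: simple_graph_def)
  moreover have "(u, v) \<in> graph_conn ?G" if "u \<in> V \<union> W" "v \<in> V \<union> W" for u v
  proof -
    have p: "(p, u) \<in> graph_conn ?G" if u: "u \<in> V \<union> W" for u
    proof (cases "u \<in> V")
      case True
      then have "(p, u) \<in> graph_conn E" using E assms(4) by (auto simp: tree_graph_iff)
      then show ?thesis by (rule graph_conn_mono) auto
    next
      case False
      then have "(c, u) \<in> graph_conn F" using F assms(5) u by (auto simp: tree_graph_iff)
      then have "(c, u) \<in> graph_conn ?G" by (rule graph_conn_mono) auto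
      then show ?thesis by (rule graph_conn_trans[OF graph_conn_edge, rotated]) simp
    qed
    show ?thesis using graph_conn_trans[OF graph_conn_sym[OF p[OF that(1)]] p[OF that(2)]] .
  qed
  moreover have "all_bridges ?G"
    unfolding all_bridges_def
  proof (intro allI impI notI)
    fix x y assume xy: "{x, y} \<in> ?G" "x \<noteq> y" "(x, y) \<in> graph_conn (?G - {{x, y}})"
    show False
    proof (cases "{x, y} = {p, c}")
      case True
      then have G: "?G - {{x, y}} = E \<union> F" using pcEF by auto
      have "(p, c) \<in> graph_conn (E \<union> F)"
        using True xy(3) unfolding G by (auto simp: doubleton_eq_iff dest: graph_conn_sym)
      then show False using graph_conn_Un_disjoint[OF sE sF disj assms(4)] assms(5) disj by auto
    next
      case False
      \<comment> \<open>The claim is general so that it also applies with the two sides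
        exchanged.\<close>
      have key: False
        if E: "tree_graph V E" and F: "tree_graph W F" and disj: "V \<inter> W = {}"
          and p: "p \<in> V" "c \<in> W" and xy: "{x, y} \<in> E" "x \<noteq> y"
          "(x, y) \<in> graph_conn (insert {p, c} (E \<union> F) - {{x, y}})"
        for V E W F p c x y
      proof -
        have sE: "simple_graph V E" and sF: "simple_graph W F"
          using E F by (auto simp: tree_graph_def)
        have xV: "x \<in> V" "y \<in> V" using simple_graph_edgeD[OF sE xy(1)] by auto
        let ?E = "E - {{x, y}}"
        \<comment> \<open>While the walk is in \<open>W\<close>, the invariant keeps that its exit
          \<open>p\<close> was reached by the remaining edges of \<open>E\<close>.\<close>
        have inv: "(v \<in> V \<longrightarrow> (x, v) \<in> graph_conn ?E) \<and> (v \<in> W \<longrightarrow> (x, p) \<in> graph_conn ?E)"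
          if "(x, v) \<in> graph_conn (insert {p, c} (E \<union> F) - {{x, y}})" for v
          using that
        proof (induction rule: graph_conn_induct)
          case refl
          then show ?case using xV disj by auto
        next
          case (step u v)
          then consider "{u, v} \<in> ?E" | "{u, v} \<in> F" | "{u, v} = {p, c}" by auto
          then show ?case
          proof cases
            case 1
            then show ?thesis
              using step simple_graph_edgeD[OF sE, of u v] disj graph_conn_step[of x u ?E v] by auto
          next
            case 2
            then show ?thesis using step simple_graph_edgeD[OF sF, of u v] disj by auto
          next
            case 3
            then show ?thesis using step p disj by (auto simp: doubleton_eq_iff)
          qed
        qed
        have "all_bridges E" using E by (simp add: tree_graph_iff)
        then show False using inv[OF xy(3)] xV xy by (auto simp: all_bridges_def)
      qed
      from False xy(1) consider "{x, y} \<in> E" | "{x, y} \<in> F" by auto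
      then show False
      proof cases
        case 1
        then show ?thesis using key[OF E F disj assms(4,5) _ xy(2,3)] by blast
      next
        case 2
        then show ?thesis
          using key[OF F E disj' assms(5,4) _ xy(2)] xy(3) by (simp add: Un_commute insert_commute)
      qed
    qed
  qed
  ultimately show ?thesis using assms(4) by (auto simp: tree_graph_iff)
qed

section \<open>Components after deleting an edge\<close>

definition graph_comp :: "'a set set \<Rightarrow> 'a \<Rightarrow> 'a set" where
  "graph_comp E v = {u. (v, u) \<in> graph_conn E}"

text \<open>A walk from \<open>v\<close> stays in its component and uses only edges that are kept;
  bridges remain bridges in a subgraph.\<close>

lemma tree_graph_comp:
  assumes G: "tree_graph V G" and E: "E \<subseteq> G" and v: "v \<in> V"
  shows "tree_graph (graph_comp E v) {e \<in> E. e \<subseteq> graph_comp E v}"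
proof -
  let ?C = "graph_comp E v" and ?F = "{e \<in> E. e \<subseteq> graph_comp E v}"
  have "simple_graph ?C ?F"
    using G E by (auto simp: tree_graph_def simple_graph_def)
  moreover have "all_bridges ?F"
    by (rule all_bridges_subset[of G]) (use G E in \<open>auto simp: tree_graph_iff\<close>)
  moreover have vu: "(v, u) \<in> graph_conn ?F" if "(v, u) \<in> graph_conn E" for u
    using that
  proof (induction rule: graph_conn_induct)
    case (step y z)
    have "{y, z} \<in> ?F"
      using step graph_conn_step[of v y E z] by (auto simp: graph_comp_def)
    with step.IH show ?case by (rule graph_conn_step)
  qed simp
  moreover have "v \<in> ?C" by (simp add: graph_comp_def)
  moreover have "(u, w) \<in> graph_conn ?F" if "u \<in> ?C" "w \<in> ?C" for u w
    using that vu by (auto simp: graph_comp_def intro: graph_conn_trans[OF graph_conn_sym])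
  ultimately show ?thesis
    unfolding tree_graph_iff by blast
qed

text \<open>A walk from \<open>p\<close> in \<open>G\<close> is at \<open>p\<close> or
  \<open>c\<close> after each crossing of the deleted edge, so one of the two reaches its end
  without that edge. The components are disjoint because the edge is a bridge.\<close>

lemma tree_graph_split:
  assumes G: "tree_graph V G" and pc: "{p, c} \<in> G"
  defines "E \<equiv> G - {{p, c}}"
  shows "V = graph_comp E p \<union> graph_comp E c" "graph_comp E p \<inter> graph_comp E c = {}"
    "E = {e \<in> E. e \<subseteq> graph_comp E p} \<union> {e \<in> E. e \<subseteq> graph_comp E c}"
proof -
  have s: "simple_graph V G" using G by (simp add: tree_graph_def)
  have p: "p \<in> V" "c \<in> V" "p \<noteq> c" using simple_graph_edgeD[OF s pc] by auto
  have sub: "graph_comp E v \<subseteq> V" if "v \<in> V" for v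
    unfolding graph_comp_def
    using graph_conn_closed[of v _ E V] that simple_graph_edgeD[OF s] by (auto simp: E_def)
  have "u \<in> graph_comp E p \<union> graph_comp E c" if "u \<in> V" for u
  proof -
    have "(p, u) \<in> graph_conn G" using G that p by (auto simp: tree_graph_iff)
    then show ?thesis
    proof (induction rule: graph_conn_induct)
      case (step y z)
      show ?case
      proof (cases "{y, z} = {p, c}")
        case False
        then have "{y, z} \<in> E" using step by (auto simp: E_def)
        then show ?thesis
          using step.IH graph_conn_step[of _ y E z] by (auto simp: graph_comp_def)
      qed (auto simp: graph_comp_def doubleton_eq_iff)
    qed (simp add: graph_comp_def)
  qed
  then show V: "V = graph_comp E p \<union> graph_comp E c" using sub p by auto
  have "(p, c) \<notin> graph_conn E"
    using G pc p by (auto simp: tree_graph_iff all_bridges_def E_def)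
  then show "graph_comp E p \<inter> graph_comp E c = {}"
    unfolding graph_comp_def by (auto dest: graph_conn_trans[OF _ graph_conn_sym])
  show "E = {e \<in> E. e \<subseteq> graph_comp E p} \<union> {e \<in> E. e \<subseteq> graph_comp E c}"
  proof -
    have "e \<subseteq> graph_comp E p \<or> e \<subseteq> graph_comp E c" if "e \<in> E" for e
    proof -
      have "e \<in> G" using that by (auto simp: E_def)
      then obtain x y where e: "e = {x, y}" "x \<in> V" by (rule simple_graph_edgeE[OF s])
      have "y \<in> graph_comp E v" if "x \<in> graph_comp E v" for v
        using that \<open>e \<in> E\<close> e(1) graph_conn_step[of v x E y] by (simp add: graph_comp_def)
      then show ?thesis
        using V e by auto
    qed
    then show ?thesis by auto
  qed
qed

section \<open>Intransitive trees\<close>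

text \<open>This is \<open>right_vertex\<close> for the order < and \<open>left_vertex\<close> for
  its converse.\<close>

definition dominates :: "('a \<Rightarrow> 'a \<Rightarrow> bool) \<Rightarrow> 'a set set \<Rightarrow> 'a \<Rightarrow> bool" where
  "dominates R E v \<longleftrightarrow> (\<forall>u. {u, v} \<in> E \<longrightarrow> R u v)"

lemma dominates_subset: "dominates R E v \<Longrightarrow> F \<subseteq> E \<Longrightarrow> dominates R F v"
  by (auto simp: dominates_def)

text \<open>The root \<open>p\<close> of the graph is not a label of the corresponding binary tree.\<close>

definition lbsts_above :: "('a \<Rightarrow> 'a \<Rightarrow> bool) \<Rightarrow> 'a \<Rightarrow> 'a set \<Rightarrow> 'a tree set" where
  "lbsts_above R p V = {T \<in> lbsts R V. T \<noteq> Leaf \<longrightarrow> R p (value T)}"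

text \<open>That the root lies below its neighbours is imposed, since deeper in the recursion it
  need not be extremal among all vertices.\<close>

definition rooted_intransitive :: "('a \<Rightarrow> 'a \<Rightarrow> bool) \<Rightarrow> 'a \<Rightarrow> 'a set \<Rightarrow> 'a set set set" where
  "rooted_intransitive R p V = {E. tree_graph (insert p V) E \<and>
     (\<forall>v\<in>V. dominates R E v \<or> dominates R\<inverse>\<inverse> E v) \<and> dominates R\<inverse>\<inverse> E p}"

text \<open>The child-sibling encoding. The right spine of \<open>T\<close> lists the children of \<open>p\<close> in the graph,
  and the left subtree of such a child encodes its own children with the order reversed.\<close>

function spine_edges :: "'a \<Rightarrow> 'a tree \<Rightarrow> 'a set set" where
  "spine_edges p Leaf = {}"
| "spine_edges p (Node l a r) = insert {p, a} (spine_edges a (mirror l) \<union> spine_edges p r)"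
  by pat_completeness auto
termination by (relation "measure (\<lambda>(p, T). size T)") auto

text \<open>These are the data for the recursion: \<open>r\<close> keeps the root \<open>p\<close>,
  as its root label lies above \<open>a\<close> and hence above \<open>p\<close>, and
  \<open>l\<close> gets the root \<open>a\<close> in the reversed order.\<close>

lemma lbsts_above_NodeD:
  assumes "strict_linear_order R" "Node l a r \<in> lbsts_above R p V" "p \<notin> V"
  shows "mirror l \<in> lbsts_above R\<inverse>\<inverse> a (set_tree l)" "r \<in> lbsts_above R p (set_tree r)" "R p a"
    "V = insert a (set_tree l \<union> set_tree r)" "a \<notin> set_tree l" "a \<notin> set_tree r"
    "set_tree l \<inter> set_tree r = {}" "p \<noteq> a" "p \<notin> set_tree l" "p \<notin> set_tree r"
proof -
  interpret strict_linear_order R by fact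
  show "mirror l \<in> lbsts_above R\<inverse>\<inverse> a (set_tree l)"
    using assms(2) by (auto simp: lbsts_above_def mirror_in_lbsts_iff) (auto simp: lbsts_def)
  show "r \<in> lbsts_above R p (set_tree r)"
    using assms(2) by (auto simp: lbsts_above_def lbsts_def intro: trans)
qed (use assms in \<open>auto simp: lbsts_above_def lbsts_def\<close>)

text \<open>Every vertex of \<open>V\<close> is connected to \<open>p\<close> and so has a
  neighbour; it cannot lie both above and below it.\<close>

lemma card_dominates_converse:
  assumes R: "strict_linear_order R" and E: "E \<in> rooted_intransitive R p V" and "p \<notin> V" "finite V"
  shows "card {v \<in> V. dominates R E v} + card {v \<in> V. dominates R\<inverse>\<inverse> E v} = card V"
proof -
  interpret strict_linear_order R by fact
  have "\<not> (dominates R E v \<and> dominates R\<inverse>\<inverse> E v)" if "v \<in> V" for v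
  proof -
    have "(v, p) \<in> graph_conn E" "v \<noteq> p"
      using E that \<open>p \<notin> V\<close> by (auto simp: rooted_intransitive_def tree_graph_iff)
    then obtain w where "{v, w} \<in> E"
      unfolding graph_conn_def by (auto elim: converse_rtranclE)
    then have "{w, v} \<in> E" by (simp add: insert_commute)
    then show ?thesis using asym by (auto simp: dominates_def)
  qed
  then have "{v \<in> V. dominates R E v} \<inter> {v \<in> V. dominates R\<inverse>\<inverse> E v} = {}" by blast
  moreover have "V = {v \<in> V. dominates R E v} \<union> {v \<in> V. dominates R\<inverse>\<inverse> E v}"
    using E by (auto simp: rooted_intransitive_def)
  ultimately show ?thesis using \<open>finite V\<close> by (metis card_Un_disjoint finite_Un)
qed

lemma size_eq_right_edges:
  "size T = right_edges T + right_edges (mirror T) + (if T = Leaf then 0 else 1)"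
  by (induction T) auto

lemma dominates_insert_Un:
  assumes "simple_graph W F" "v \<notin> W" "v \<noteq> p" "v \<noteq> a"
  shows "dominates R (insert {p, a} (E \<union> F)) v \<longleftrightarrow> dominates R E v"
  using simple_graph_edgeD[OF assms(1)] assms(2-) by (auto simp: dominates_def doubleton_eq_iff)

text \<open>By induction both subtrees give disjoint trees, joined by the edge from \<open>p\<close>
  to \<open>a\<close>. The vertices counted are \<open>a\<close>, those from \<open>r\<close>, and
  in \<open>l\<close> the complement of those counted for the reversed order.\<close>

lemma spine_edges_intransitive:
  assumes "strict_linear_order R" "T \<in> lbsts_above R p V" "p \<notin> V"
  shows "spine_edges p T \<in> rooted_intransitive R p V \<and>
    card {v \<in> V. dominates R (spine_edges p T) v} = right_edges T + (if T = Leaf then 0 else 1)"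
  using assms
proof (induction p T arbitrary: R V rule: spine_edges.induct)
  case (1 p)
  then have "V = {}" by (simp add: lbsts_above_def)
  then show ?case by (simp add: rooted_intransitive_def tree_graph_singleton dominates_def)
next
  case (2 p l a r)
  note D = lbsts_above_NodeD[OF 2(3-5)]
  have R': "strict_linear_order R\<inverse>\<inverse>" by (rule strict_linear_order.converse) fact
  let ?L = "set_tree l" and ?Q = "set_tree r"
  let ?E = "spine_edges a (mirror l)" and ?F = "spine_edges p r"
  let ?G = "insert {p, a} (?E \<union> ?F)"
  have E: "?E \<in> rooted_intransitive R\<inverse>\<inverse> a ?L"
    "card {v \<in> ?L. dominates R\<inverse>\<inverse> ?E v} = right_edges (mirror l) + (if l = Leaf then 0 else 1)"
    using 2(1)[OF R' D(1) D(5)] unfolding mirror_Leaf by blast+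
  have F: "?F \<in> rooted_intransitive R p ?Q"
    "card {v \<in> ?Q. dominates R ?F v} = right_edges r + (if r = Leaf then 0 else 1)"
    using 2(2)[OF 2(3) D(2) D(10)] by blast+
  have tE: "tree_graph (insert a ?L) ?E" and tF: "tree_graph (insert p ?Q) ?F"
    using E F by (auto simp: rooted_intransitive_def)
  then have sE: "simple_graph (insert a ?L) ?E" and sF: "simple_graph (insert p ?Q) ?F"
    by (auto simp: tree_graph_def)
  have "tree_graph (insert p ?Q \<union> insert a ?L) (insert {p, a} (?F \<union> ?E))"
    by (rule tree_graph_join[OF tF tE]) (use D in auto)
  then have "tree_graph (insert p V) ?G"
    using D(4) by (simp add: Un_commute insert_commute)
  moreover have domL: "dominates S ?G v \<longleftrightarrow> dominates S ?E v" if "v \<in> ?L" for v S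
    by (rule dominates_insert_Un[OF sF]) (use that D in auto)
  moreover have domQ: "dominates S ?G v \<longleftrightarrow> dominates S ?F v" if "v \<in> ?Q" for v S
    unfolding Un_commute[of ?E]
    by (rule dominates_insert_Un[OF sE]) (use that D in auto)
  \<comment> \<open>In the left part \<open>a\<close> lies below its neighbours for the reversed
    order, that is, above them for \<open>R\<close>; its remaining neighbour \<open>p\<close> is
    below it too.\<close>
  moreover have dom_a: "dominates R ?G a"
    using E(1) D(3) simple_graph_edgeD[OF sF, of _ a] D(6,8)
    by (auto simp: rooted_intransitive_def dominates_def doubleton_eq_iff)
  moreover have "dominates R\<inverse>\<inverse> ?G p"
    using F(1) D(3) simple_graph_edgeD[OF sE, of _ p] D(8,9)
    by (auto simp: rooted_intransitive_def dominates_def doubleton_eq_iff)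
  ultimately have "?G \<in> rooted_intransitive R p V"
    using E(1) F(1) D(4) by (auto simp: rooted_intransitive_def)
  moreover have "card {v \<in> V. dominates R ?G v} =
      right_edges (Node l a r) + (if Node l a r = Leaf then 0 else 1)"
  proof -
    have "{v \<in> V. dominates R ?G v} =
        insert a ({v \<in> ?L. dominates R ?E v} \<union> {v \<in> ?Q. dominates R ?F v})"
      using D(4) dom_a domL domQ by auto
    moreover have "card \<dots> = Suc (card {v \<in> ?L. dominates R ?E v} + card {v \<in> ?Q. dominates R ?F v})"
    proof -
      have "{v \<in> ?L. dominates R ?E v} \<inter> {v \<in> ?Q. dominates R ?F v} = {}" using D(7) by auto
      moreover have "a \<notin> {v \<in> ?L. dominates R ?E v} \<union> {v \<in> ?Q. dominates R ?F v}" using D(5,6) by auto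
      ultimately show ?thesis by (simp add: card_Un_disjoint)
    qed
    \<comment> \<open>The reversed order counts the left edges of \<open>l\<close>, plus one if
      \<open>l\<close> is nonempty; the remaining nodes are as many as its right edges.\<close>
    moreover have "card {v \<in> ?L. dominates R ?E v} = right_edges l"
    proof -
      have "card {v \<in> ?L. dominates R\<inverse>\<inverse> ?E v} + card {v \<in> ?L. dominates R ?E v} = card ?L"
        using card_dominates_converse[OF R' E(1) D(5)] by simp
      moreover have "card ?L = size l"
        using 2(4) size_eq_card_iff[of l] by (simp add: lbsts_above_def lbsts_def)
      ultimately show ?thesis using E(2) size_eq_right_edges[of l] by simp
    qed
    ultimately show ?thesis using F(2) by simp
  qed
  ultimately show ?case by simp
qed

section \<open>Surjectivity and injectivity of the encoding\<close>

lemma (in strict_linear_order) finite_has_least: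
  "finite N \<Longrightarrow> N \<noteq> {} \<Longrightarrow> \<exists>c\<in>N. \<forall>x\<in>N. x = c \<or> R c x"
proof (induction N rule: finite_ne_induct)
  case (insert y N)
  then obtain c where c: "c \<in> N" "\<forall>x\<in>N. x = c \<or> R c x" by blast
  show ?case
  proof (cases "R y c")
    case True
    then have "x = y \<or> R y x" if "x \<in> insert y N" for x
      using that c(2) trans[of y c x] by auto
    then show ?thesis by blast
  next
    case False
    then have "R c y" using total[of y c] c insert by auto
    then have "x = c \<or> R c x" if "x \<in> insert y N" for x
      using that c(2) by auto
    then show ?thesis using c(1) by blast
  qed
qed simp

text \<open>Deleting the edge from \<open>p\<close> to its least neighbour \<open>c\<close> leaves
  two smaller trees: that of \<open>p\<close> yields the right subtree, that of \<open>c\<close> the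
  left one for the reversed order.\<close>

lemma spine_edges_surj:
  assumes "strict_linear_order R" "E \<in> rooted_intransitive R p V" "p \<notin> V" "finite V"
  shows "\<exists>T\<in>lbsts_above R p V. spine_edges p T = E"
  using assms
proof (induction "card V" arbitrary: R E p V rule: less_induct)
  case less
  interpret strict_linear_order R by fact
  have R': "strict_linear_order R\<inverse>\<inverse>" by (rule converse)
  have tE: "tree_graph (insert p V) E" using less.prems by (simp add: rooted_intransitive_def)
  then have sE: "simple_graph (insert p V) E" by (simp add: tree_graph_def)
  show ?case
  proof (cases "V = {}")
    case True
    then have "E = {}" using tE by (simp add: tree_graph_singleton)
    then show ?thesis using True by (auto simp: lbsts_above_def)
  next
    case False
    define N where "N = {c. {p, c} \<in> E}"
    have "N \<subseteq> V" using simple_graph_edgeD[OF sE, of p] by (auto simp: N_def)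
    then have "finite N" using \<open>finite V\<close> finite_subset by blast
    obtain v where "v \<in> V" using False by blast
    then have "(p, v) \<in> graph_conn E" "v \<noteq> p"
      using tE \<open>p \<notin> V\<close> by (auto simp: tree_graph_iff)
    then have "N \<noteq> {}"
      unfolding graph_conn_def N_def by (auto elim: converse_rtranclE)
    then obtain c where c: "c \<in> N" "\<And>x. x \<in> N \<Longrightarrow> x = c \<or> R c x"
      using finite_has_least[OF \<open>finite N\<close>] by blast
    have pc: "{p, c} \<in> E" and cV: "c \<in> V" using c(1) \<open>N \<subseteq> V\<close> by (auto simp: N_def)
    define F where "F = E - {{p, c}}"
    define P C where "P = graph_comp F p" and "C = graph_comp F c"
    define E1 E2 where "E1 = {e \<in> F. e \<subseteq> P}" and "E2 = {e \<in> F. e \<subseteq> C}"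
    note split = tree_graph_split[OF tE pc, folded F_def, folded P_def C_def, folded E1_def E2_def]
    have sub: "E1 \<subseteq> E" "E2 \<subseteq> E" by (auto simp: E1_def E2_def F_def)
    have pP: "p \<in> P" "c \<in> C" by (auto simp: P_def C_def graph_comp_def)
    have t1: "tree_graph P E1" unfolding E1_def P_def
      by (rule tree_graph_comp[OF tE]) (auto simp: F_def)
    have t2: "tree_graph C E2" unfolding E2_def C_def
      by (rule tree_graph_comp[OF tE]) (use cV in \<open>auto simp: F_def\<close>)
    have dom: "dominates R E v \<or> dominates R\<inverse>\<inverse> E v" if "v \<in> V" for v
      using less.prems that by (auto simp: rooted_intransitive_def)
    have dom_p: "dominates R\<inverse>\<inverse> E p" using less.prems by (auto simp: rooted_intransitive_def)
    \<comment> \<open>Since \<open>p\<close> lies below \<open>c\<close>, the vertex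
      \<open>c\<close> is above all its neighbours, which is the root condition for the reversed
      order.\<close>
    then have "R p c" using pc by (auto simp: dominates_def insert_commute)
    then have "\<not> dominates R\<inverse>\<inverse> E c" using pc asym by (auto simp: dominates_def)
    then have dom_c: "dominates R E c" using dom cV by blast
    have PV: "P - {p} \<subseteq> V" "C - {c} \<subseteq> V" "c \<notin> P" "p \<notin> C"
      using split(1,2) pP by auto
    have ins: "insert p (P - {p}) = P" "insert c (C - {c}) = C" using pP by auto
    have E1: "E1 \<in> rooted_intransitive R p (P - {p})"
      using t1 PV dom dom_p dominates_subset[OF _ sub(1)]
      unfolding rooted_intransitive_def ins by blast
    have "card (P - {p}) < card V"
      using PV cV \<open>finite V\<close> by (intro psubset_card_mono) auto
    from less.hyps[OF this less.prems(1) E1 _ finite_subset[OF PV(1) \<open>finite V\<close>]]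
    obtain r where r: "r \<in> lbsts_above R p (P - {p})" "spine_edges p r = E1"
      by auto
    have E2: "E2 \<in> rooted_intransitive R\<inverse>\<inverse> c (C - {c})"
      using t2 PV dom dom_c dominates_subset[OF _ sub(2)]
      unfolding rooted_intransitive_def ins conversep_conversep by blast
    have "card (C - {c}) < card V"
      using PV cV \<open>finite V\<close> by (intro psubset_card_mono) auto
    from less.hyps[OF this R' E2 _ finite_subset[OF PV(2) \<open>finite V\<close>]]
    obtain l where l: "l \<in> lbsts_above R\<inverse>\<inverse> c (C - {c})" "spine_edges c l = E2"
      by blast
    \<comment> \<open>The label \<open>value r\<close> is a neighbour of \<open>p\<close> other than
      \<open>c\<close>, and \<open>c\<close> is the least one.\<close>
    have "R c (value r)" if "r \<noteq> Leaf"
    proof -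
      have "{p, value r} \<in> spine_edges p r" using that by (cases r) auto
      then have "value r \<in> N" using r(2) sub by (auto simp: N_def)
      moreover have "value r \<in> P" using r(1) that value_in_set_tree by (auto simp: lbsts_above_def lbsts_def)
      ultimately show ?thesis using c(2) PV(3) by auto
    qed
    then have "Node (mirror l) c r \<in> lbsts_above R p V"
      using r(1) l(1) \<open>R p c\<close> split(1,2) pP PV \<open>p \<notin> V\<close>
      by (auto simp: lbsts_above_def lbsts_def inorder_mirror)
    moreover have "spine_edges p (Node (mirror l) c r) = E"
      using r(2) l(2) split(3) pc by (auto simp: F_def)
    ultimately show ?thesis by blast
  qed
qed

lemma tree_graph_recover:
  assumes "tree_graph V E" "tree_graph W F" "V \<inter> W = {}" "p \<in> V"
  shows "graph_comp (E \<union> F) p = V" "{e \<in> E \<union> F. e \<subseteq> V} = E"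
proof -
  have s: "simple_graph V E" "simple_graph W F" using assms by (auto simp: tree_graph_def)
  have "(p, v) \<in> graph_conn (E \<union> F)" if "v \<in> V" for v
    by (rule graph_conn_mono[of _ _ E]) (use assms that in \<open>auto simp: tree_graph_iff\<close>)
  then show "graph_comp (E \<union> F) p = V"
    using graph_conn_Un_disjoint[OF s assms(3,4)] by (auto simp: graph_comp_def)
  have "\<not> e \<subseteq> V" if "e \<in> F" for e
    using that by (rule simple_graph_edgeE[OF s(2)]) (use assms(3) in auto)
  moreover have "e \<subseteq> V" if "e \<in> E" for e using s(1) that by (auto simp: simple_graph_def)
  ultimately show "{e \<in> E \<union> F. e \<subseteq> V} = E" by auto
qed

text \<open>The neighbours of \<open>p\<close> lie on the right spine, where labels increase; the
  edges from left subtrees do not touch \<open>p\<close>.\<close>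

lemma value_least_neighbour:
  assumes "strict_linear_order R" "T \<in> lbsts_above R p V" "p \<notin> V" "{p, x} \<in> spine_edges p T"
  shows "x = value T \<or> R (value T) x"
  using assms
proof (induction T arbitrary: V)
  case (Node l a r)
  interpret strict_linear_order R by fact
  note D = lbsts_above_NodeD[OF Node.prems(1-3)]
  have R': "strict_linear_order R\<inverse>\<inverse>" by (rule converse)
  have "spine_edges a (mirror l) \<in> rooted_intransitive R\<inverse>\<inverse> a (set_tree l)"
    using spine_edges_intransitive[OF R' D(1) D(5)] by blast
  then have "simple_graph (insert a (set_tree l)) (spine_edges a (mirror l))"
    by (auto simp: rooted_intransitive_def tree_graph_def)
  then have "{p, x} \<notin> spine_edges a (mirror l)"
    using simple_graph_edgeD D(8,9) by fast
  then consider "x = a" | "{p, x} \<in> spine_edges p r"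
    using Node.prems(4) by (auto simp: doubleton_eq_iff)
  then show ?case
  proof cases
    case 2
    then have "x = value r \<or> R (value r) x" using Node.IH(2)[OF Node.prems(1) D(2) D(10)] by blast
    moreover have "r \<noteq> Leaf" using 2 by auto
    then have "R a (value r)" using Node.prems(2) by (auto simp: lbsts_above_def lbsts_def)
    ultimately show ?thesis using trans by auto
  qed simp
qed simp

text \<open>The root label is recovered as the least neighbour of \<open>p\<close>. Deleting that
  edge leaves the graphs of the two subtrees as components, to which induction applies.\<close>

lemma spine_edges_inj:
  assumes "strict_linear_order R" "T \<in> lbsts_above R p V" "T' \<in> lbsts_above R p V" "p \<notin> V"
    "spine_edges p T = spine_edges p T'"
  shows "T = T'"
  using assms
proof (induction p T arbitrary: R V T' rule: spine_edges.induct)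
  case (1 p)
  then show ?case by (simp add: lbsts_above_def)
next
  case (2 p l a r)
  interpret strict_linear_order R by fact
  have R': "strict_linear_order R\<inverse>\<inverse>" by (rule converse)
  obtain l' a' r' where T': "T' = Node l' a' r'"
    using 2(4,5) by (cases T') (auto simp: lbsts_above_def lbsts_def)
  have T'_in: "Node l' a' r' \<in> lbsts_above R p V" using 2(5) T' by simp
  note D = lbsts_above_NodeD[OF 2(3,4,6)] and D' = lbsts_above_NodeD[OF 2(3) T'_in 2(6)]
  have "{p, a} \<in> spine_edges p (Node l a r)" "{p, a'} \<in> spine_edges p T'"
    by (simp_all add: T')
  then have "{p, a} \<in> spine_edges p T'" "{p, a'} \<in> spine_edges p (Node l a r)"
    unfolding 2(7) by blast+
  then have "a = a' \<or> R a' a" "a' = a \<or> R a a'"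
    using value_least_neighbour[OF 2(3) 2(5) 2(6), of a] value_least_neighbour[OF 2(3) 2(4) 2(6), of a']
    by (simp_all add: T')
  then have a: "a' = a" using asym by blast
  have t: "tree_graph (insert a (set_tree l)) (spine_edges a (mirror l)) \<and>
      tree_graph (insert p (set_tree r)) (spine_edges p r) \<and>
      insert p (set_tree r) \<inter> insert a (set_tree l) = {} \<and>
      spine_edges p r \<union> spine_edges a (mirror l) = spine_edges p (Node l a r) - {{p, a}}"
    if T: "Node l a r \<in> lbsts_above R p V" for l r
  proof -
    note D = lbsts_above_NodeD[OF 2(3) T 2(6)]
    have t: "tree_graph (insert a (set_tree l)) (spine_edges a (mirror l))"
      "tree_graph (insert p (set_tree r)) (spine_edges p r)"
      using spine_edges_intransitive[OF R' D(1) D(5)] spine_edges_intransitive[OF 2(3) D(2) D(10)]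
      by (auto simp: rooted_intransitive_def)
    then have "{p, a} \<notin> spine_edges a (mirror l)" "{p, a} \<notin> spine_edges p r"
      using simple_graph_edgeD[of _ _ p a] D(6,8,9) by (auto simp: tree_graph_def)
    then show ?thesis using t D by auto
  qed
  define F where "F = spine_edges p (Node l a r) - {{p, a}}"
  have F': "F = spine_edges p (Node l' a r') - {{p, a}}" using 2(7) T' a by (simp add: F_def)
  note t1 = t[OF 2(4), folded F_def] and t2 = t[OF T'_in[unfolded a], folded F']
  have p1: "graph_comp F p = insert p (set_tree r) \<and> {e \<in> F. e \<subseteq> insert p (set_tree r)} = spine_edges p r \<and>
      graph_comp F a = insert a (set_tree l) \<and> {e \<in> F. e \<subseteq> insert a (set_tree l)} = spine_edges a (mirror l)"
    if "tree_graph (insert a (set_tree l)) (spine_edges a (mirror l)) \<and>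
      tree_graph (insert p (set_tree r)) (spine_edges p r) \<and>
      insert p (set_tree r) \<inter> insert a (set_tree l) = {} \<and>
      spine_edges p r \<union> spine_edges a (mirror l) = F" for l r
  proof -
    from that have t: "tree_graph (insert p (set_tree r)) (spine_edges p r)"
      "tree_graph (insert a (set_tree l)) (spine_edges a (mirror l))"
      and d: "insert p (set_tree r) \<inter> insert a (set_tree l) = {}"
      and F: "spine_edges p r \<union> spine_edges a (mirror l) = F" by auto
    show ?thesis
      using tree_graph_recover[OF t d, of p] tree_graph_recover[OF t(2,1), of a] d
      unfolding Un_commute[of "spine_edges a (mirror l)"] F by (simp add: Int_commute)
  qed
  have eqs: "insert p (set_tree r) = insert p (set_tree r')" "spine_edges p r = spine_edges p r'"
    "insert a (set_tree l) = insert a (set_tree l')" "spine_edges a (mirror l) = spine_edges a (mirror l')"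
    using p1[OF t1] p1[OF t2] by auto
  have sets: "set_tree r' = set_tree r" "set_tree l' = set_tree l"
    using eqs D(5,10) D'(5,10) a insert_ident by metis+
  have "r = r'"
    by (rule 2(2)[OF 2(3) D(2) D'(2)[unfolded sets] D(10) eqs(2)])
  moreover have "mirror l = mirror l'"
    by (rule 2(1)[OF R' D(1) D'(1)[unfolded sets a] D(5) eqs(4)])
  then have "l = l'" by (metis mirror_mirror)
  ultimately show ?case using T' a by simp
qed

section \<open>Specialization to the vertex set [n+1]\<close>

lemma intransitive_trees_eq:
  "intransitive_trees (n + 1) = rooted_intransitive (<) 1 {2..n + 1}"
proof -
  have V: "{1..n + 1} = insert 1 {2..n + 1}" by auto
  \<comment> \<open>Vertex 1 is the least one, so the root condition holds automatically.\<close>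
  have "left_vertex E 1" if "tree_graph (insert 1 {2..n + 1}) E" for E
  proof -
    have "simple_graph (insert 1 {2..n + 1}) E" using that by (simp add: tree_graph_def)
    from simple_graph_edgeD[OF this, of _ 1] show ?thesis by (force simp: left_vertex_def)
  qed
  moreover have "right_vertex E v \<longleftrightarrow> dominates (<) E v" "left_vertex E v \<longleftrightarrow> dominates (<)\<inverse>\<inverse> E v" for E v
    by (auto simp: right_vertex_def left_vertex_def dominates_def)
  ultimately show ?thesis
    unfolding intransitive_trees_def rooted_intransitive_def V by auto
qed

lemma lbsts_above_eq: "lbsts_above (<) 1 {2..n + 1} = lbsts (<) {2..n + 1}" for n :: nat
proof -
  have "1 < value T" if "T \<in> lbsts (<) {2..n + 1}" "T \<noteq> Leaf" for T
    using value_in_set_tree[OF that(2)] that(1) by (auto simp: lbsts_def)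
  then show ?thesis by (auto simp: lbsts_above_def)
qed

lemma bij_betw_spine_edges:
  "bij_betw (spine_edges 1) (lbsts (<) {2..n + 1}) (intransitive_trees (n + 1))"
proof -
  have 1: "(1::nat) \<notin> {2..n + 1}" by simp
  show ?thesis
    unfolding intransitive_trees_eq lbsts_above_eq[symmetric] bij_betw_def
    using spine_edges_inj[OF strict_linear_order_less _ _ 1]
      spine_edges_surj[OF strict_linear_order_less _ 1]
      spine_edges_intransitive[OF strict_linear_order_less _ 1]
    by (auto simp: inj_on_def image_iff) (metis finite_atLeastAtMost)
qed

text \<open>For \<open>n \<ge> 1\<close> vertex 1 has a neighbour and is no right vertex, so the
  general count over the other vertices applies.\<close>

lemma card_right_vertices:
  assumes "n \<ge> 1" "T \<in> lbsts (<) {2..n + 1}"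
  shows "card {v \<in> {1..n + 1}. right_vertex (spine_edges 1 T) v} = Suc (right_edges T)"
proof -
  let ?E = "spine_edges 1 T"
  have T: "T \<in> lbsts_above (<) 1 {2..n + 1}" "T \<noteq> Leaf"
    using assms lbsts_above_eq by auto
  have "{value T, 1} \<in> ?E" using T(2) by (cases T) (auto simp: insert_commute)
  moreover have "\<not> value T < 1"
    using T(1) \<open>T \<noteq> Leaf\<close> by (simp add: lbsts_above_def)
  ultimately have "\<not> right_vertex ?E 1" unfolding right_vertex_def by blast
  moreover have "v = 1 \<or> v \<in> {2..n + 1}" if "v \<in> {1..n + 1}" for v using that by auto
  ultimately have "{v \<in> {1..n + 1}. right_vertex ?E v} = {v \<in> {2..n + 1}. dominates (<) ?E v}"
    by (auto simp: right_vertex_def dominates_def)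
  then show ?thesis
    using spine_edges_intransitive[OF strict_linear_order_less T(1)] T(2) by simp
qed

text \<open>A binary tree with k - 1 right edges encodes a graph with k right vertices, whence the
  factor t.\<close>

lemma intransitive_poly_eq:
  assumes "n \<ge> 1"
  shows "intransitive_poly n = monom 1 1 * local_bst_poly n"
proof -
  let ?L = "lbsts (<) {2..n + 1}"
  have fin: "finite ?L" by (rule finite_lbsts) simp
  have count: "intransitive_count n k = card {T \<in> ?L. Suc (right_edges T) = k}" for k
  proof -
    have "bij_betw (spine_edges 1) {T \<in> ?L. Suc (right_edges T) = k}
        {E \<in> intransitive_trees (n + 1). card {v \<in> {1..n + 1}. right_vertex E v} = k}"
      by (rule bij_betw_Collect[OF bij_betw_spine_edges]) (simp only: card_right_vertices[OF assms])
    from bij_betw_same_card[OF this] show ?thesis by (simp only: intransitive_count_def)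
  qed
  have "intransitive_poly n = (\<Sum>k = 1..n + 1. \<Sum>T\<in>{T \<in> ?L. Suc (right_edges T) = k}. monom 1 (Suc (right_edges T)))"
    unfolding intransitive_poly_def count
    by (intro sum.cong refl) (simp add: of_nat_poly smult_monom mult.commute)
  also have "\<dots> = (\<Sum>T\<in>?L. monom 1 (Suc (right_edges T)))"
  proof (rule sum.group[OF fin])
    have "right_edges T \<le> n" if "T \<in> ?L" for T
      using that size_eq_right_edges[of T] size_eq_card_iff[of T] by (auto simp: lbsts_def)
    then show "(\<lambda>T. Suc (right_edges T)) ` ?L \<subseteq> {1..n + 1}" by auto
  qed simp
  also have "\<dots> = (\<Sum>T\<in>lbsts (<) {1..n}. monom 1 (Suc (right_edges T)))"
  proof -
    \<comment> \<open>The root 1 of the graph is not a label of the binary tree; shifting the labels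
      restores {1..n}.\<close>
    have "bij_betw Suc {1..n} {2..n + 1}"
      by (rule bij_betw_byWitness[of _ "\<lambda>i. i - 1"]) auto
    then have "bij_betw (map_tree Suc) (lbsts (<) {1..n}) ?L"
      by (rule bij_betw_map_tree_lbsts) simp
    from sum.reindex_bij_betw[OF this, of "\<lambda>T. monom 1 (Suc (right_edges T))", symmetric]
    show ?thesis by (simp only: right_edges_map_tree)
  qed
  also have "\<dots> = monom 1 1 * local_bst_poly n"
    unfolding local_bst_poly_def standard_local_bsts_eq
    by (simp add: sum_distrib_left mult_monom)
  finally show ?thesis .
qed

theorem theorem6p2:
  fixes n :: nat
  assumes "n \<ge> 1"
  shows "gamma_nonneg (local_bst_poly n) \<and>
    (\<exists>q. intransitive_poly n = monom 1 1 * q \<and> gamma_nonneg q) \<and>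
    unimodal (coeff (intransitive_poly n))"
  \<comment> \<open>The witness for \<open>q\<close> is \<open>local_bst_poly n\<close>.\<close>
  using gamma_nonneg_local_bst_poly[OF assms] intransitive_poly_eq[OF assms]
    unimodal_coeff_gamma_nonneg by auto

end
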